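(* Let $\Bbbk$ be a field of characteristic different from $2$, let $V$ be a finite-dimensional $\Bbbk$-vector space with ordered basis $(x_1,\dots,x_n)$, and let $A=\bigwedge^*V$ be its exterior algebra, viewed as a Frobenius algebra with respect to the bilinear form $\langle a,b\rangle=\int(a\wedge b)$, with Nakayama automorphism $\sigma$. For every algebra automorphism $u:A\to A$ belonging to $\mathrm{Aut}_{\mathsf{od}}(A)$ we have $$\mathrm{jac}_\sigma(u^{-1})=\mathrm{jac}(u)^{-1}.$$
   Context: $\int:A\to\Bbbk$ is the linear form vanishing on $\bigwedge^iV$ for $0\le i\le n-1$ with $\int(x_1\wedge\cdots\wedge x_n)=1$. The form $\langle a,b\rangle=\int(a\wedge b)$ is non-degenerate and associative ($\langle ab,c\rangle=\langle a,bc\rangle$), and its Nakayama automorphism is the unique algebra automorphism $\sigma$ of $A$ with $\langle a,b\rangle=\langle b,\sigma(a)\rangle$ for all $a,b\in A$. For an algebra endomorphism $u$ of $A$, the Nakayama Jacobian $\mathrm{jac}_\sigma(u)$ is the unique element of $A$ such that $\langle u(a),u(b)\rangle=\langle\mathrm{jac}_\sigma(u)\cdot a,b\rangle$ for all $a,b\in A$. $A^{\mathsf{od}}$ and $A^{\mathsf{ev}}$ are the subspaces of $A$ spanned by the homogeneous elements of odd and of even degree; $A^{\mathsf{ev}}$ is contained in the center of $A$. $\mathrm{Aut}_{\mathsf{od}}(A)=\{u\in\mathrm{Aut}(A):u(V)\subseteq A^{\mathsf{od}}\}$, where $\mathrm{Aut}(A)$ is the group of all algebra automorphisms of $A$. A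 left skew derivation of $A$ is a linear map $\partial:A\to A$ with $\partial(ab)=\partial(a)b+(-1)^ia\,\partial(b)$ whenever $a\in\bigwedge^iV$ and $b\in A$. For each $j$, $\frac{\partial}{\partial x_j}:A\to A$ is the unique left skew derivation with $\frac{\partial}{\partial x_j}(x_i)=\delta_{i,j}$ for all $i$. For $u\in\mathrm{Aut}_{\mathsf{od}}(A)$, Bavula's Jacobian is $\mathrm{jac}(u)=\det\left(\frac{\partial u(x_i)}{\partial x_j}\right)_{i,j}\in A^{\mathsf{ev}}$, a determinant of a matrix with entries in the commutative ring $A^{\mathsf{ev}}$; it is a unit. *)

theory Defs
  imports
    Complex_Main
    "HOL-Library.Poly_Mapping"
    "HOL-Combinatorics.Permutations"
begin

locale assoc_algebra = vector_space scale
  for scale :: "'k::field \<Rightarrow> 'a::ring_1 \<Rightarrow> 'a" +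
  assumes scale_mult_left: "scale c a * b = scale c (a * b)"
    and scale_mult_right: "a * scale c b = scale c (a * b)"

definition algebra_endomorphism ::
    "('k::field \<Rightarrow> 'a::ring_1 \<Rightarrow> 'a) \<Rightarrow> ('a \<Rightarrow> 'a) \<Rightarrow> bool" where
  "algebra_endomorphism scale u \<longleftrightarrow>
     Vector_Spaces.linear scale scale u \<and> u 1 = 1 \<and> (\<forall>a b. u (a * b) = u a * u b)"

definition algebra_automorphism ::
    "('k::field \<Rightarrow> 'a::ring_1 \<Rightarrow> 'a) \<Rightarrow> ('a \<Rightarrow> 'a) \<Rightarrow> bool" where
  "algebra_automorphism scale u \<longleftrightarrow> algebra_endomorphism scale u \<and> bij u"

text \<open>
  The exterior algebra of a vector space \<open>V\<close> (all of the type \<open>'v\<close>, with scalar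
  multiplication \<open>scaleV\<close>) is the tensor algebra modulo the two-sided ideal generated by
  the \<open>v \<otimes> v\<close>. The tensor algebra in turn is the free algebra on the set \<open>V\<close> modulo the
  relations saying that the inclusion of \<open>V\<close> is linear. An element of the free algebra is a
  finitely supported function from words over \<open>V\<close> to scalars; the set below is the
  two-sided ideal generated by all these relations together. Multiples of the relations by
  elements of the free algebra are sums of multiples by a scalar and by words \<open>p\<close>, \<open>q\<close> on the
  two sides.
\<close>

inductive_set exterior_ideal ::
    "('k::field \<Rightarrow> 'v::ab_group_add \<Rightarrow> 'v) \<Rightarrow> ('v list \<Rightarrow>\<^sub>0 'k) set"
  for scaleV :: "'k::field \<Rightarrow> 'v::ab_group_add \<Rightarrow> 'v"
where
  zero: "0 \<in> exterior_ideal scaleV"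
| add: "f \<in> exterior_ideal scaleV \<Longrightarrow> g \<in> exterior_ideal scaleV
    \<Longrightarrow> f + g \<in> exterior_ideal scaleV"
| additive: "Poly_Mapping.single (p @ [v + w] @ q) c
    - Poly_Mapping.single (p @ [v] @ q) c - Poly_Mapping.single (p @ [w] @ q) c
    \<in> exterior_ideal scaleV"
| homogeneous: "Poly_Mapping.single (p @ [scaleV d v] @ q) c
    - Poly_Mapping.single (p @ [v] @ q) (c * d) \<in> exterior_ideal scaleV"
| square: "Poly_Mapping.single (p @ [v, v] @ q) c \<in> exterior_ideal scaleV"

definition free_eval ::
    "('k::field \<Rightarrow> 'a::ring_1 \<Rightarrow> 'a) \<Rightarrow> ('v \<Rightarrow> 'a) \<Rightarrow> ('v list \<Rightarrow>\<^sub>0 'k) \<Rightarrow> 'a" where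
  "free_eval scale \<iota> f =
     (\<Sum>w\<in>Poly_Mapping.keys f. scale (Poly_Mapping.lookup f w) (prod_list (map \<iota> w)))"

text \<open>
  \<open>A\<close> (all of the type \<open>'a\<close>) together with \<open>\<iota> : V \<rightarrow> A\<close> is the exterior algebra of \<open>V\<close>:
  the algebra homomorphism from the free algebra on \<open>V\<close> to \<open>A\<close> which extends \<open>\<iota>\<close> induces an
  isomorphism from the quotient by \<open>exterior_ideal\<close> onto \<open>A\<close>.
\<close>

locale exterior_algebra =
  V: vector_space scaleV + A: assoc_algebra scale
  for scaleV :: "'k::field \<Rightarrow> 'v::ab_group_add \<Rightarrow> 'v"
    and scale :: "'k \<Rightarrow> 'a::ring_1 \<Rightarrow> 'a"
    and \<iota> :: "'v \<Rightarrow> 'a" +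
  assumes surj_free_eval: "surj (free_eval scale \<iota>)"
    and free_eval_eq_0_iff: "free_eval scale \<iota> f = 0 \<longleftrightarrow> f \<in> exterior_ideal scaleV"

definition ordered_basis ::
    "('k::field \<Rightarrow> 'v::ab_group_add \<Rightarrow> 'v) \<Rightarrow> nat \<Rightarrow> (nat \<Rightarrow> 'v) \<Rightarrow> bool" where
  "ordered_basis scaleV n x \<longleftrightarrow>
     inj_on x {1..n} \<and> \<not> module.dependent scaleV (x ` {1..n}) \<and>
     module.span scaleV (x ` {1..n}) = UNIV"

definition ext_power ::
    "('k::field \<Rightarrow> 'a::ring_1 \<Rightarrow> 'a) \<Rightarrow> ('v \<Rightarrow> 'a) \<Rightarrow> nat \<Rightarrow> 'a set" where
  "ext_power scale \<iota> i = module.span scale {prod_list (map \<iota> vs) | vs. length vs = i}"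

definition ext_odd :: "('k::field \<Rightarrow> 'a::ring_1 \<Rightarrow> 'a) \<Rightarrow> ('v \<Rightarrow> 'a) \<Rightarrow> 'a set" where
  "ext_odd scale \<iota> = module.span scale (\<Union>i\<in>{i. odd i}. ext_power scale \<iota> i)"

definition Aut_odd ::
    "('k::field \<Rightarrow> 'a::ring_1 \<Rightarrow> 'a) \<Rightarrow> ('v \<Rightarrow> 'a) \<Rightarrow> ('a \<Rightarrow> 'a) set" where
  "Aut_odd scale \<iota> = {u. algebra_automorphism scale u \<and> u ` range \<iota> \<subseteq> ext_odd scale \<iota>}"

definition ext_integral ::
    "('k::field \<Rightarrow> 'a::ring_1 \<Rightarrow> 'a) \<Rightarrow> ('v \<Rightarrow> 'a) \<Rightarrow> nat \<Rightarrow> (nat \<Rightarrow> 'v) \<Rightarrow> 'a \<Rightarrow> 'k" where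
  "ext_integral scale \<iota> n x =
     (THE f. Vector_Spaces.linear scale (*) f \<and>
        (\<forall>i<n. \<forall>a\<in>ext_power scale \<iota> i. f a = 0) \<and>
        f (prod_list (map (\<lambda>i. \<iota> (x i)) [1..<Suc n])) = 1)"

definition ext_form ::
    "('k::field \<Rightarrow> 'a::ring_1 \<Rightarrow> 'a) \<Rightarrow> ('v \<Rightarrow> 'a) \<Rightarrow> nat \<Rightarrow> (nat \<Rightarrow> 'v) \<Rightarrow> 'a \<Rightarrow> 'a \<Rightarrow> 'k" where
  "ext_form scale \<iota> n x a b = ext_integral scale \<iota> n x (a * b)"

definition nakayama_automorphism ::
    "('k::field \<Rightarrow> 'a::ring_1 \<Rightarrow> 'a) \<Rightarrow> ('a \<Rightarrow> 'a \<Rightarrow> 'k) \<Rightarrow> 'a \<Rightarrow> 'a" where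
  "nakayama_automorphism scale form =
     (THE \<sigma>. algebra_automorphism scale \<sigma> \<and> (\<forall>a b. form a b = form b (\<sigma> a)))"

text \<open>The Nakayama automorphism does not occur in the equation defining the Nakayama Jacobian.\<close>

definition nakayama_jacobian ::
    "('a::ring_1 \<Rightarrow> 'a \<Rightarrow> 'k::field) \<Rightarrow> ('a \<Rightarrow> 'a) \<Rightarrow> 'a" where
  "nakayama_jacobian form u = (THE j. \<forall>a b. form (u a) (u b) = form (j * a) b)"

definition left_skew_derivation ::
    "('k::field \<Rightarrow> 'a::ring_1 \<Rightarrow> 'a) \<Rightarrow> ('v \<Rightarrow> 'a) \<Rightarrow> ('a \<Rightarrow> 'a) \<Rightarrow> bool" where
  "left_skew_derivation scale \<iota> d \<longleftrightarrow>
     Vector_Spaces.linear scale scale d \<and>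
     (\<forall>i. \<forall>a\<in>ext_power scale \<iota> i. \<forall>b. d (a * b) = d a * b + (-1) ^ i * a * d b)"

definition ext_partial ::
    "('k::field \<Rightarrow> 'a::ring_1 \<Rightarrow> 'a) \<Rightarrow> ('v \<Rightarrow> 'a) \<Rightarrow> nat \<Rightarrow> (nat \<Rightarrow> 'v) \<Rightarrow> nat \<Rightarrow> 'a \<Rightarrow> 'a" where
  "ext_partial scale \<iota> n x j =
     (THE d. left_skew_derivation scale \<iota> d \<and>
        (\<forall>i\<in>{1..n}. d (\<iota> (x i)) = (if i = j then 1 else 0)))"

text \<open>
  The determinant of an \<open>n \<times> n\<close> matrix, indexed from 1, whose entries lie in a commutative
  subring of \<open>'a\<close>, by the Leibniz formula. The factors are multiplied in the order of the
  rows; their order is immaterial for such matrices.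
\<close>

definition leibniz_det :: "nat \<Rightarrow> (nat \<Rightarrow> nat \<Rightarrow> 'a::ring_1) \<Rightarrow> 'a" where
  "leibniz_det n M =
     (\<Sum>p | p permutes {1..n}. of_int (sign p) * prod_list (map (\<lambda>i. M i (p i)) [1..<Suc n]))"

definition bavula_jacobian ::
    "('k::field \<Rightarrow> 'a::ring_1 \<Rightarrow> 'a) \<Rightarrow> ('v \<Rightarrow> 'a) \<Rightarrow> nat \<Rightarrow> (nat \<Rightarrow> 'v) \<Rightarrow> ('a \<Rightarrow> 'a) \<Rightarrow> 'a" where
  "bavula_jacobian scale \<iota> n x u =
     leibniz_det n (\<lambda>i j. ext_partial scale \<iota> n x j (u (\<iota> (x i))))"

definition is_inverse_of :: "'a::ring_1 \<Rightarrow> 'a \<Rightarrow> bool" where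
  "is_inverse_of b a \<longleftrightarrow> a * b = 1 \<and> b * a = 1"

end

theory Submission
  imports Defs
begin

text \<open>
  The assertion is the change of variables formula for the Berezin integral. Write
  \<open>M\<^sub>k\<^sub>l = \<partial>\<^sub>l u(x\<^sub>k)\<close>, \<open>D = det M\<close> and \<open>v = u\<^sup>-\<^sup>1\<close>; the point is that
  \<open>\<integral> v(D c) = \<integral> c\<close> for all \<open>c\<close>. Up to a scalar, the integral is the only linear form that vanishes on
  all derivatives \<open>\<partial>\<^sub>j a\<close>. That \<open>c \<mapsto> \<integral> v(D c)\<close> vanishes on them follows by the chain rule
  \<open>\<partial>\<^sub>l = \<Sum>\<^sub>k M\<^sub>k\<^sub>l T\<^sub>k\<close> with \<open>T\<^sub>k = u \<partial>\<^sub>k v\<close> and integration by parts from the identity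
  \<open>\<Sum>\<^sub>k T\<^sub>k (D M\<^sub>k\<^sub>j) = 0\<close>, which rests on \<open>\<partial>\<^sub>j \<partial>\<^sub>m = - \<partial>\<^sub>m \<partial>\<^sub>j\<close>. The scalar is 1, because on
  \<open>c = u(x\<^sub>1 \<dots> x\<^sub>n)\<close> both forms give the constant term of \<open>D\<close>. That constant term is non-zero, so
  \<open>D\<close> is a unit and \<open>\<integral> v(c) = \<integral> D\<^sup>-\<^sup>1 c\<close>.
\<close>

section \<open>Sums over index functions and permutations\<close>

lemma prod_list_sum_distrib:
  fixes g :: "'i \<Rightarrow> 'j \<Rightarrow> 'a::semiring_1"
  assumes "distinct is" "finite S"
  shows "prod_list (map (\<lambda>i. \<Sum>j\<in>S. g i j) is) =
    (\<Sum>f\<in>PiE (set is) (\<lambda>_. S). prod_list (map (\<lambda>i. g i (f i)) is))"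
  using assms(1)
proof (induction "is")
  case (Cons i "is")
  let ?P = "PiE (set is) (\<lambda>_. S)"
  \<comment> \<open>The choice functions on \<open>i # is\<close> are those on \<open>is\<close>
    updated at \<open>i\<close>; the update loses nothing because \<open>i\<close> does not occur in
    \<open>is\<close>.\<close>
  have inj: "inj_on (\<lambda>(y, f). f(i := y)) (S \<times> ?P)"
    using Cons.prems by (intro inj_combinator[of i "set is" "\<lambda>_. S"]) simp
  have "prod_list (map (\<lambda>i. \<Sum>j\<in>S. g i j) (i # is)) =
      (\<Sum>(j, f)\<in>S \<times> ?P. g i j * prod_list (map (\<lambda>i. g i (f i)) is))"
    using Cons by (simp add: sum_product sum.cartesian_product)
  also have "\<dots> = (\<Sum>f\<in>(\<lambda>(y, f). f(i := y)) ` (S \<times> ?P). prod_list (map (\<lambda>i. g i (f i)) (i # is)))"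
    unfolding sum.reindex[OF inj] using Cons.prems
    by (intro sum.cong refl) (auto intro!: arg_cong2[where f = "(*)"] arg_cong[where f = prod_list])
  also have "(\<lambda>(y, f). f(i := y)) ` (S \<times> ?P) = PiE (set (i # is)) (\<lambda>_. S)"
    by (simp add: PiE_insert_eq)
  finally show ?case .
qed simp

text \<open>Turns the expansion of an alternating multilinear expression into a Leibniz sum. An
  injective self-map of the finite set \<open>S\<close> is a bijection. It becomes a permutation
  once its value \<open>undefined\<close> outside \<open>S\<close> is replaced by the identity, and
  the assumption on \<open>restrict\<close> says that \<open>h\<close> does not see this
  change.\<close>

lemma sum_PiE_inj_eq_sum_permutes:
  fixes h :: "('i \<Rightarrow> 'i) \<Rightarrow> 'b::comm_monoid_add"
  assumes "finite S"
    and zero: "\<And>f. f \<in> PiE S (\<lambda>_. S) \<Longrightarrow> \<not> inj_on f S \<Longrightarrow> h f = 0"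
    and restrict: "\<And>p. h (restrict p S) = h p"
  shows "(\<Sum>f\<in>PiE S (\<lambda>_. S). h f) = (\<Sum>p | p permutes S. h p)"
proof -
  have "(\<Sum>f\<in>PiE S (\<lambda>_. S). h f) = (\<Sum>f\<in>{f \<in> PiE S (\<lambda>_. S). inj_on f S}. h f)"
    using assms by (intro sum.mono_neutral_right) (auto intro: finite_PiE)
  also have "\<dots> = (\<Sum>p | p permutes S. h p)"
  proof (rule sum.reindex_bij_witness[where i = "\<lambda>p. restrict p S"
        and j = "\<lambda>f i. if i \<in> S then f i else i"])
    fix f
    assume f: "f \<in> {f \<in> PiE S (\<lambda>_. S). inj_on f S}"
    let ?p = "\<lambda>i. if i \<in> S then f i else i"
    show fp: "restrict ?p S = f"
      using f by (auto simp: fun_eq_iff restrict_def PiE_def extensional_def)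
    have "inj_on ?p S" using f by (auto simp: inj_on_def)
    moreover have "?p ` S \<subseteq> S" using f by auto
    ultimately have "bij_betw ?p S S"
      using endo_inj_surj[OF assms(1)] by (simp only: bij_betw_def)
    then show "?p \<in> {p. p permutes S}" by (auto intro!: bij_imp_permutes)
    show "h ?p = h f" using restrict[of ?p] fp by simp
  next
    fix p
    assume "p \<in> {p. p permutes S}"
    then have p: "p permutes S" by simp
    then show "(\<lambda>i. if i \<in> S then restrict p S i else i) = p"
      by (auto simp: fun_eq_iff permutes_not_in)
    show "restrict p S \<in> {f \<in> PiE S (\<lambda>_. S). inj_on f S}"
      using p by (auto simp: permutes_in_image inj_on_def dest: permutes_inj_on inj_onD[OF permutes_inj_on[OF p]])
  qed
  finally show ?thesis .
qed

subsection \<open>The universal property and the grading\<close>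

text \<open>\<open>free_eval\<close> is the instance in which a word is sent to its product in the
  algebra. The target is arbitrary because the universal property sends the same formal combination
  of words to a second space.\<close>

definition (in vector_space) lin_ext :: "('w \<Rightarrow> 'b) \<Rightarrow> ('w \<Rightarrow>\<^sub>0 'a) \<Rightarrow> 'b" where
  "lin_ext h f = (\<Sum>w\<in>Poly_Mapping.keys f. scale (Poly_Mapping.lookup f w) (h w))"

context vector_space
begin

lemma lin_ext_superset:
  assumes "finite S" "Poly_Mapping.keys f \<subseteq> S"
  shows "lin_ext h f = (\<Sum>w\<in>S. scale (Poly_Mapping.lookup f w) (h w))"
  unfolding lin_ext_def using assms
  by (intro sum.mono_neutral_left) (auto simp: in_keys_iff)

lemma lin_ext_zero [simp]: "lin_ext h 0 = 0"
  by (simp add: lin_ext_def)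

lemma lin_ext_single [simp]: "lin_ext h (Poly_Mapping.single w c) = scale c (h w)"
  by (simp add: lin_ext_def)

lemma lin_ext_add: "lin_ext h (f + g) = lin_ext h f + lin_ext h g"
proof -
  let ?S = "Poly_Mapping.keys f \<union> Poly_Mapping.keys g"
  have "Poly_Mapping.keys (f + g) \<subseteq> ?S" by (rule Poly_Mapping.keys_add)
  then show ?thesis
    by (simp add: lin_ext_superset[where S = ?S] lookup_add scale_left_distrib sum.distrib)
qed

lemma lin_ext_diff: "lin_ext h (f - g) = lin_ext h f - lin_ext h g"
  using lin_ext_add[of h "f - g" g] by simp

lemma lin_ext_scale: "lin_ext h (Poly_Mapping.map ((*) c) f) = scale c (lin_ext h f)"
proof -
  have "Poly_Mapping.keys (Poly_Mapping.map ((*) c) f) \<subseteq> Poly_Mapping.keys f"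
    by (auto simp: in_keys_iff Poly_Mapping.map.rep_eq)
  then show ?thesis
    by (auto simp: lin_ext_superset[where S = "Poly_Mapping.keys f"] Poly_Mapping.map.rep_eq
        scale_sum_right when_def in_keys_iff intro!: sum.cong)
qed

end

context exterior_algebra
begin

definition wedge :: "'v list \<Rightarrow> 'a" where
  "wedge vs = prod_list (map \<iota> vs)"

lemma wedge_Nil [simp]: "wedge [] = 1"
  and wedge_Cons [simp]: "wedge (v # vs) = \<iota> v * wedge vs"
  and wedge_append: "wedge (vs @ ws) = wedge vs * wedge ws"
  by (simp_all add: wedge_def)

lemma free_eval_conv_lin_ext: "free_eval scale \<iota> = A.lin_ext wedge"
  by (simp add: fun_eq_iff free_eval_def A.lin_ext_def wedge_def)

text \<open>The conditions on \<open>h\<close> say that its linear extension kills the generators of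
  \<open>exterior_ideal\<close>, which is the kernel of \<open>free_eval\<close>; hence it factors
  through the algebra. The property is stated for linear maps, not for homomorphisms, since it must
  also produce the parity projection and the contractions.\<close>

lemma wedge_universal:
  fixes s' :: "'k \<Rightarrow> 'b::ab_group_add \<Rightarrow> 'b"
  assumes "vector_space s'"
    and additive: "\<And>p v w q. h (p @ [v + w] @ q) = h (p @ [v] @ q) + h (p @ [w] @ q)"
    and homogeneous: "\<And>p c v q. h (p @ [scaleV c v] @ q) = s' c (h (p @ [v] @ q))"
    and square: "\<And>p v q. h (p @ [v, v] @ q) = 0"
  shows "\<exists>f. Vector_Spaces.linear scale s' f \<and> (\<forall>vs. f (wedge vs) = h vs)"
proof -
  interpret B: vector_space s' by fact
  have ideal: "B.lin_ext h f = 0" if "f \<in> exterior_ideal scaleV" for f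
    using that
    by induction
      (use additive homogeneous square in \<open>auto simp: B.lin_ext_add B.lin_ext_diff B.scale_right_distrib\<close>)
  \<comment> \<open>The choice of a representative is harmless: two of them differ by an element of
    the ideal.\<close>
  define F where "F a = B.lin_ext h (SOME f. free_eval scale \<iota> f = a)" for a
  have F: "F (A.lin_ext wedge f) = B.lin_ext h f" for f
  proof -
    let ?g = "SOME g. free_eval scale \<iota> g = A.lin_ext wedge f"
    have "free_eval scale \<iota> ?g = A.lin_ext wedge f"
      by (rule someI[of _ f]) (simp add: free_eval_conv_lin_ext)
    then have "free_eval scale \<iota> (?g - f) = 0"
      by (simp add: free_eval_conv_lin_ext A.lin_ext_diff)
    then have "B.lin_ext h (?g - f) = 0"
      using ideal free_eval_eq_0_iff by blast
    then show ?thesis by (simp add: F_def B.lin_ext_diff)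
  qed
  have surj: "\<exists>f. a = A.lin_ext wedge f" for a
    using surj_free_eval by (metis free_eval_conv_lin_ext surjD)
  have "Vector_Spaces.linear scale s' F"
  proof (unfold_locales)
    fix a b c
    obtain f g where "a = A.lin_ext wedge f" "b = A.lin_ext wedge g"
      using surj by meson
    then show "F (a + b) = F a + F b" "F (scale c a) = s' c (F a)"
      by (metis F A.lin_ext_add B.lin_ext_add, metis F A.lin_ext_scale B.lin_ext_scale)
  qed
  moreover have "F (wedge vs) = h vs" for vs
    using F[of "Poly_Mapping.single vs 1"] by simp
  ultimately show ?thesis by blast
qed

lemma iota_add: "\<iota> (v + w) = \<iota> v + \<iota> w"
proof -
  have "\<iota> (v + w) - \<iota> v - \<iota> w = 0"
    using free_eval_eq_0_iff[THEN iffD2, OF exterior_ideal.additive[where p = "[]" and q = "[]" and c = 1]]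
    by (simp add: free_eval_conv_lin_ext A.lin_ext_diff)
  then show ?thesis by (simp add: algebra_simps)
qed

lemma iota_scale: "\<iota> (scaleV c v) = scale c (\<iota> v)"
  using free_eval_eq_0_iff[THEN iffD2, OF exterior_ideal.homogeneous[where p = "[]" and q = "[]" and c = 1]]
  by (simp add: free_eval_conv_lin_ext A.lin_ext_diff)

lemma iota_square: "\<iota> v * \<iota> v = 0"
  using free_eval_eq_0_iff[THEN iffD2, OF exterior_ideal.square[where p = "[]" and q = "[]" and c = 1]]
  by (simp add: free_eval_conv_lin_ext)

lemma wedge_append_add: "wedge (p @ (v + w) # q) = wedge (p @ v # q) + wedge (p @ w # q)"
  by (simp add: wedge_append iota_add algebra_simps)

lemma wedge_append_scale: "wedge (p @ scaleV c v # q) = scale c (wedge (p @ v # q))"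
  by (simp add: wedge_append iota_scale A.scale_mult_left A.scale_mult_right)

lemma wedge_append_square: "wedge (p @ v # v # q) = 0"
  by (simp add: wedge_append flip: mult.assoc[of "\<iota> v"]) (simp add: iota_square)

text \<open>Polarization of the relation that squares vanish.\<close>

lemma iota_anticommute: "\<iota> v * \<iota> w = - (\<iota> w * \<iota> v)"
  using iota_square[of "v + w"]
  by (simp add: iota_add algebra_simps iota_square eq_neg_iff_add_eq_0)

lemma iota_zero [simp]: "\<iota> 0 = 0"
  using iota_add[of 0 0] by simp

lemma iota_sum: "\<iota> (\<Sum>i\<in>S. f i) = (\<Sum>i\<in>S. \<iota> (f i))"
  by (induction S rule: infinite_finite_induct) (auto simp: iota_add)

section \<open>Signs, degrees and parity\<close>

lemma wedge_commute_iota: "wedge vs * \<iota> w = (-1) ^ length vs * (\<iota> w * wedge vs)"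
proof (induction vs)
  case (Cons v vs)
  have "wedge (v # vs) * \<iota> w = \<iota> v * ((-1) ^ length vs * (\<iota> w * wedge vs))"
    using Cons by (simp add: mult.assoc)
  also have "\<dots> = (-1) ^ length vs * (\<iota> v * \<iota> w * wedge vs)"
    by (cases "even (length vs)") (auto simp: mult.assoc)
  also have "\<dots> = (-1) ^ length (v # vs) * (\<iota> w * wedge (v # vs))"
    by (simp add: iota_anticommute[of v w] mult.assoc)
  finally show ?case .
qed simp

lemma wedge_commute:
  "wedge vs * wedge ws = (-1) ^ (length vs * length ws) * (wedge ws * wedge vs)"
proof (induction ws)
  case (Cons w ws)
  have "wedge vs * wedge (w # ws) = (-1) ^ length vs * \<iota> w * (wedge vs * wedge ws)"
    using wedge_commute_iota[of vs w] by (simp flip: mult.assoc)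
  also have "\<dots> = (-1) ^ length vs * \<iota> w * ((-1) ^ (length vs * length ws) * (wedge ws * wedge vs))"
    using Cons by simp
  also have "\<dots> = (-1) ^ (length vs * length (w # ws)) * (wedge (w # ws) * wedge vs)"
    by (cases "even (length vs)"; cases "even (length ws)")
      (auto simp: mult.assoc power_add)
  finally show ?case .
qed simp

text \<open>A set of degrees in place of a single degree treats exterior powers \<open>{i}\<close>,
  parity parts and the degree filtration \<open>{k..}\<close> uniformly.\<close>

definition graded :: "nat set \<Rightarrow> 'a set" where
  "graded L = A.span {wedge vs | vs. length vs \<in> L}"

lemma graded_induct [consumes 1, case_names wedge zero add scale]:
  assumes "a \<in> graded L" "\<And>vs. length vs \<in> L \<Longrightarrow> P (wedge vs)" "P 0"
    and "\<And>a b. a \<in> graded L \<Longrightarrow> b \<in> graded L \<Longrightarrow> P a \<Longrightarrow> P b \<Longrightarrow> P (a + b)"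
    and "\<And>c a. a \<in> graded L \<Longrightarrow> P a \<Longrightarrow> P (scale c a)"
  shows "P a"
proof -
  have "a \<in> graded L \<and> P a"
    using assms(1) unfolding graded_def
  proof (induction rule: A.span_induct_alt)
    case base
    show ?case using assms(3) by (simp add: A.span_zero)
  next
    case (step c b a)
    then obtain vs where vs: "b = wedge vs" "length vs \<in> L" by auto
    then have "wedge vs \<in> A.span {wedge vs | vs. length vs \<in> L}"
      by (intro A.span_base) auto
    then show ?case using step vs assms(2,4,5)
      by (simp add: A.span_add A.span_scale graded_def)
  qed
  then show ?thesis ..
qed

lemma wedge_in_graded [intro]: "length vs \<in> L \<Longrightarrow> wedge vs \<in> graded L"
  unfolding graded_def by (intro A.span_base) auto

lemma subspace_graded: "A.subspace (graded L)"
  by (simp add: graded_def)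

lemmas graded_zero [simp, intro] = A.subspace_0[OF subspace_graded]
  and graded_add = A.subspace_add[OF subspace_graded]
  and graded_diff = A.subspace_diff[OF subspace_graded]
  and graded_neg = A.subspace_neg[OF subspace_graded]
  and graded_scale = A.subspace_scale[OF subspace_graded]
  and graded_sum = A.subspace_sum[OF subspace_graded]

lemma graded_mono: "L \<subseteq> L' \<Longrightarrow> a \<in> graded L \<Longrightarrow> a \<in> graded L'"
  unfolding graded_def using A.span_mono[of "{wedge vs | vs. length vs \<in> L}"
    "{wedge vs | vs. length vs \<in> L'}"] by blast

lemma graded_UNIV: "a \<in> graded UNIV"
proof -
  have "A.lin_ext wedge f \<in> graded UNIV" for f
    unfolding A.lin_ext_def by (intro graded_sum graded_scale) auto
  then show ?thesis
    using surj_free_eval by (metis free_eval_conv_lin_ext surjD)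
qed

lemmas wedge_induct = graded_induct[OF graded_UNIV, case_names wedge zero add scale]

lemma linear_image_graded:
  assumes "Vector_Spaces.linear scale scale f" "a \<in> graded L"
    and "\<And>vs. length vs \<in> L \<Longrightarrow> f (wedge vs) \<in> graded L'"
  shows "f a \<in> graded L'"
proof -
  interpret f: Vector_Spaces.linear scale scale f by fact
  show ?thesis using assms(2)
    by (induction rule: graded_induct)
      (auto simp: f.add f.scale f.zero graded_add graded_scale assms(3))
qed

lemma graded_mult:
  assumes "a \<in> graded L" "b \<in> graded L'" "\<And>i j. i \<in> L \<Longrightarrow> j \<in> L' \<Longrightarrow> i + j \<in> L''"
  shows "a * b \<in> graded L''"
  using assms(1)
proof (induction rule: graded_induct)
  case (wedge vs)
  show ?case using assms(2)
    by (induction rule: graded_induct)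
      (auto simp: graded_add graded_scale distrib_left A.scale_mult_right assms(3) wedge
        simp flip: wedge_append intro!: wedge_in_graded)
qed (auto simp: graded_add graded_scale distrib_right A.scale_mult_left)

lemma ext_power_conv_graded: "ext_power scale \<iota> i = graded {i}"
  by (simp add: ext_power_def graded_def wedge_def)

lemma ext_odd_subset_graded: "ext_odd scale \<iota> \<subseteq> graded {i. odd i}"
  unfolding ext_odd_def
  by (intro A.span_minimal subspace_graded)
    (auto simp: ext_power_conv_graded elim!: graded_mono[rotated])

abbreviation "Ev \<equiv> graded {i. even i}"
abbreviation "Od \<equiv> graded {i. odd i}"

lemma Ev_commute:
  assumes "a \<in> Ev"
  shows "a * b = b * a"
  using assms
proof (induction rule: graded_induct)
  case (wedge vs)
  show ?case
    by (induction b rule: wedge_induct)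
      (use wedge in \<open>auto simp: wedge_commute[of vs] A.scale_mult_left A.scale_mult_right algebra_simps\<close>)
qed (auto simp: A.scale_mult_left A.scale_mult_right algebra_simps)

lemma Ev_one [simp, intro]: "1 \<in> Ev"
  using wedge_in_graded[of "[]"] by simp

lemma Ev_mult: "a \<in> Ev \<Longrightarrow> b \<in> Ev \<Longrightarrow> a * b \<in> Ev"
  by (rule graded_mult) auto

lemma Ev_prod_list: "(\<And>a. a \<in> set as \<Longrightarrow> a \<in> Ev) \<Longrightarrow> prod_list as \<in> Ev"
  by (induction as) (auto intro: Ev_mult)

lemma Ev_Od_decompose: "\<exists>e\<in>Ev. \<exists>d\<in>Od. a = e + d"
proof (induction a rule: wedge_induct)
  case (wedge vs)
  show ?case
  proof (cases "even (length vs)")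
    case True
    then have "wedge vs \<in> Ev" by auto
    then show ?thesis by (intro bexI[of _ "wedge vs"] bexI[of _ 0]) auto
  next
    case False
    then have "wedge vs \<in> Od" by auto
    then show ?thesis by (intro bexI[of _ "wedge vs"] bexI[of _ 0]) auto
  qed
next
  case zero
  show ?case by (intro bexI[of _ 0]) auto
next
  case (add a b)
  then obtain e d e' d' where "e \<in> Ev" "d \<in> Od" "a = e + d" "e' \<in> Ev" "d' \<in> Od" "b = e' + d'"
    by blast
  then show ?case
    by (intro bexI[of _ "e + e'"] bexI[of _ "d + d'"]) (auto simp: graded_add)
next
  case (scale c a)
  then obtain e d where "e \<in> Ev" "d \<in> Od" "a = e + d" by blast
  then show ?case
    by (intro bexI[of _ "scale c e"] bexI[of _ "scale c d"])
      (auto simp: graded_scale A.scale_right_distrib)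
qed

text \<open>The projection to the even part fixes \<open>a\<close> as an even element and kills it
  as an odd one. It exists because the linearity relations only involve words of equal length and
  squares vanish anyway.\<close>

lemma Ev_Int_Od:
  assumes "a \<in> Ev" "a \<in> Od"
  shows "a = 0"
proof -
  let ?h = "\<lambda>vs. if even (length vs) then wedge vs else 0"
  have "\<exists>f. Vector_Spaces.linear scale scale f \<and> (\<forall>vs. f (wedge vs) = ?h vs)"
    by (rule wedge_universal[OF A.vector_space_axioms])
      (auto simp: wedge_append_add wedge_append_scale wedge_append_square)
  then obtain P where P: "Vector_Spaces.linear scale scale P" "\<And>vs. P (wedge vs) = ?h vs"
    by blast
  interpret P: Vector_Spaces.linear scale scale P by fact
  have "P a = a" using assms(1)
    by (induction rule: graded_induct) (auto simp: P.add P.scale P.zero P(2))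
  moreover have "P a = 0" using assms(2)
    by (induction rule: graded_induct) (auto simp: P.add P.scale P.zero P(2))
  ultimately show ?thesis by simp
qed

section \<open>The constant term\<close>

lemma ex_augmentation:
  "\<exists>\<epsilon>. Vector_Spaces.linear scale (*) \<epsilon> \<and> (\<forall>vs. \<epsilon> (wedge vs) = (if vs = [] then 1 else 0))"
  by (rule wedge_universal) (auto intro!: vector_space.intro simp: algebra_simps)

text \<open>The constant term of an element. It detects units and reads off the linear parts of odd
  elements.\<close>

definition aug :: "'a \<Rightarrow> 'k" where
  "aug = (SOME \<epsilon>. Vector_Spaces.linear scale (*) \<epsilon> \<and>
    (\<forall>vs. \<epsilon> (wedge vs) = (if vs = [] then 1 else 0)))"

lemma linear_aug: "Vector_Spaces.linear scale (*) aug"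
  and aug_wedge: "aug (wedge vs) = (if vs = [] then 1 else 0)"
  using someI_ex[OF ex_augmentation] by (simp_all add: aug_def)

lemma aug_add: "aug (a + b) = aug a + aug b"
  and aug_scale: "aug (scale c a) = c * aug a"
  and aug_zero [simp]: "aug 0 = 0"
proof -
  interpret aug: Vector_Spaces.linear scale "(*)" aug by (rule linear_aug)
  show "aug (a + b) = aug a + aug b" "aug (scale c a) = c * aug a" "aug 0 = 0"
    by (rule aug.add aug.scale aug.zero)+
qed

lemma aug_one [simp]: "aug 1 = 1"
  using aug_wedge[of "[]"] by simp

lemma aug_mult: "aug (a * b) = aug a * aug b"
proof (induction a rule: wedge_induct)
  case (wedge vs)
  show ?case
    by (induction b rule: wedge_induct)
      (auto simp: aug_add aug_scale distrib_left A.scale_mult_right aug_wedge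
        simp flip: wedge_append)
qed (auto simp: aug_add aug_scale distrib_right A.scale_mult_left)

lemma aug_prod_list: "aug (prod_list as) = prod_list (map aug as)"
  by (induction as) (auto simp: aug_mult)

lemma aug_graded: "a \<in> graded L \<Longrightarrow> 0 \<notin> L \<Longrightarrow> aug a = 0"
  by (induction rule: graded_induct) (auto simp: aug_add aug_scale aug_wedge)

lemma diff_aug_in_graded: "a - scale (aug a) 1 \<in> graded {1..}"
proof (induction a rule: wedge_induct)
  case (wedge vs)
  show ?case by (cases vs) (auto simp: aug_wedge simp flip: wedge_Cons)
next
  case (add a b)
  then show ?case
    using graded_add[OF add(3,4)] by (simp add: aug_add A.scale_left_distrib algebra_simps)
next
  case (scale c a)
  then show ?case
    using graded_scale[OF scale(2), of c] by (simp add: aug_scale A.scale_right_diff_distrib)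
qed auto

lemma graded_empty: "a \<in> graded {} \<Longrightarrow> a = 0"
  by (induction rule: graded_induct) auto

text \<open>The second copy of a repeated vector moves next to the first at the cost of a sign, and
  squares vanish.\<close>

lemma wedge_not_distinct:
  assumes "\<not> distinct vs"
  shows "wedge vs = 0"
proof -
  obtain xs ys zs y where vs: "vs = xs @ [y] @ ys @ [y] @ zs"
    using not_distinct_decomp[OF assms] by blast
  have "\<iota> y * wedge ys * \<iota> y = (-1) ^ length ys * (\<iota> y * \<iota> y * wedge ys)"
    by (cases "even (length ys)") (auto simp: wedge_commute_iota mult.assoc)
  then have "\<iota> y * (wedge ys * \<iota> y) = 0" by (simp add: iota_square mult.assoc)
  then show ?thesis by (simp add: vs wedge_append flip: mult.assoc)
qed

text \<open>The lowest part of a product of elements without constant term is the product of their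
  linear parts.\<close>

lemma prod_list_leading_part:
  assumes "\<And>i. i \<in> set is \<Longrightarrow> f i - g i \<in> graded {2..}" "\<And>i. i \<in> set is \<Longrightarrow> g i \<in> graded {1}"
  shows "prod_list (map g is) \<in> graded {length is} \<and>
    prod_list (map f is) - prod_list (map g is) \<in> graded {length is<..}"
  using assms
proof (induction "is")
  case Nil
  show ?case using wedge_in_graded[of "[]" "{0}"] by simp
next
  case (Cons i "is")
  let ?F = "prod_list (map f is)" and ?G = "prod_list (map g is)"
  have IH: "?G \<in> graded {length is}" "?F - ?G \<in> graded {length is<..}"
    using Cons by auto
  have i: "f i - g i \<in> graded {2..}" "g i \<in> graded {1}" using Cons.prems by auto
  have "?G + (?F - ?G) \<in> graded {length is..}"
    by (intro graded_add) (rule graded_mono[OF _ IH(1)] graded_mono[OF _ IH(2)]; force)+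
  then have F: "?F \<in> graded {length is..}" by simp
  have "g i * ?G \<in> graded {length (i # is)}"
    by (rule graded_mult[OF i(2) IH(1)]) auto
  \<comment> \<open>This sum telescopes to \<open>f i * ?F - g i * ?G\<close>, and each summand
    gains a degree from one of the two differences.\<close>
  moreover have "(f i - g i) * ?F + g i * (?F - ?G) \<in> graded {length (i # is)<..}"
    by (intro graded_add graded_mult[OF i(1) F] graded_mult[OF i(2) IH(2)]) auto
  ultimately show ?case by (simp add: algebra_simps)
qed

end

subsection \<open>Partial derivatives and the integral\<close>

locale exterior_basis = exterior_algebra scaleV scale \<iota>
  for scaleV :: "'k::field \<Rightarrow> 'v::ab_group_add \<Rightarrow> 'v"
    and scale :: "'k \<Rightarrow> 'a::ring_1 \<Rightarrow> 'a"
    and \<iota> :: "'v \<Rightarrow> 'a" +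
  fixes n :: nat and x :: "nat \<Rightarrow> 'v"
  assumes basis: "ordered_basis scaleV n x"
begin

section \<open>Coordinates and contraction\<close>

declare One_nat_def [simp del] upt_Suc [simp del] atLeastLessThanSuc_atLeastAtMost [simp]

text \<open>The value 0 for \<open>j\<close> outside \<open>{1..n}\<close> agrees with
  \<open>ext_partial\<close>, which then kills every basis vector; so the rules for derivatives hold
  for all \<open>j\<close>.\<close>

definition coord :: "nat \<Rightarrow> 'v \<Rightarrow> 'k" where
  "coord j v = (if j \<in> {1..n} then V.representation (x ` {1..n}) v (x j) else 0)"

lemma basis_inj: "inj_on x {1..n}"
  and basis_indep: "V.independent (x ` {1..n})"
  and basis_span: "v \<in> V.span (x ` {1..n})"
  using basis by (simp_all add: ordered_basis_def)

lemma coord_add: "coord j (v + w) = coord j v + coord j w"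
  by (simp add: coord_def V.representation_add basis_indep basis_span)

lemma coord_scale: "coord j (scaleV c v) = c * coord j v"
  by (simp add: coord_def V.representation_scale basis_indep basis_span)

lemma coord_basis: "i \<in> {1..n} \<Longrightarrow> coord j (x i) = (if i = j then 1 else 0)"
  using basis_inj by (auto simp: coord_def V.representation_basis basis_indep inj_on_eq_iff)

lemma basis_expand: "v = (\<Sum>j\<in>{1..n}. scaleV (coord j v) (x j))"
proof -
  have "v = (\<Sum>b\<in>x ` {1..n}. scaleV (V.representation (x ` {1..n}) v b) b)"
    by (rule V.sum_representation_eq[symmetric]) (auto simp: basis_indep basis_span)
  also have "\<dots> = (\<Sum>j\<in>{1..n}. scaleV (coord j v) (x j))"
    by (subst sum.reindex[OF basis_inj]) (auto simp: coord_def)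
  finally show ?thesis .
qed

text \<open>Interior product with the \<open>j\<close>-th dual basis vector, given on words so that
  \<open>wedge_universal\<close> applies. The recursion is the skew product rule for a first factor
  of degree 1.\<close>

primrec contract :: "nat \<Rightarrow> 'v list \<Rightarrow> 'a" where
  "contract j [] = 0"
| "contract j (v # vs) = scale (coord j v) (wedge vs) - \<iota> v * contract j vs"

lemma contract_add: "contract j (p @ (v + w) # q) = contract j (p @ v # q) + contract j (p @ w # q)"
  by (induction p)
    (auto simp: coord_add wedge_append_add iota_add algebra_simps)

lemma contract_scale: "contract j (p @ scaleV c v # q) = scale c (contract j (p @ v # q))"
  by (induction p)
    (auto simp: coord_scale wedge_append_scale iota_scale A.scale_right_diff_distrib
      A.scale_mult_left A.scale_mult_right A.scale_left_commute)

text \<open>At the repeated vector the two coordinate terms cancel, and what remains contains its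
  square.\<close>

lemma contract_square: "contract j (p @ v # v # q) = 0"
proof (induction p)
  case Nil
  show ?case
    by (simp add: right_diff_distrib A.scale_mult_right iota_square flip: mult.assoc)
qed (simp add: wedge_append_square)

lemma ex_contract:
  "\<exists>d. Vector_Spaces.linear scale scale d \<and> (\<forall>vs. d (wedge vs) = contract j vs)"
  by (rule wedge_universal[OF A.vector_space_axioms])
    (simp_all add: contract_add contract_scale contract_square)

lemma contract_iota_mult:
  assumes "Vector_Spaces.linear scale scale d" and d: "\<And>vs. d (wedge vs) = contract j vs"
  shows "d (\<iota> v * b) = scale (coord j v) b - \<iota> v * d b"
proof -
  interpret d: Vector_Spaces.linear scale scale d by fact
  show ?thesis
  proof (induction b rule: wedge_induct)
    case (wedge vs)
    show ?case using d[of vs] d[of "v # vs"] by simp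
  next
    case (add a b)
    then show ?case by (simp add: d.add algebra_simps)
  next
    case (scale c a)
    then show ?case
      by (simp add: d.scale A.scale_mult_right A.scale_right_diff_distrib A.scale_left_commute)
  qed (simp add: d.zero)
qed

lemma contract_wedge_mult:
  assumes "Vector_Spaces.linear scale scale d" and d: "\<And>vs. d (wedge vs) = contract j vs"
  shows "d (wedge vs * b) = d (wedge vs) * b + (-1) ^ length vs * wedge vs * d b"
proof (induction vs)
  case Nil
  show ?case using d[of "[]"] by simp
next
  case (Cons v vs)
  have sgn: "\<iota> v * ((-1) ^ m * w) = (-1) ^ m * (\<iota> v * w)" for m w
    by (cases "even m") auto
  show ?case
    using Cons by (simp add: contract_iota_mult[OF assms] mult.assoc algebra_simps
        A.scale_mult_left sgn)
qed

lemma left_skew_derivation_unique: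
  assumes "left_skew_derivation scale \<iota> d"
    and d: "\<And>i. i \<in> {1..n} \<Longrightarrow> d (\<iota> (x i)) = (if i = j then 1 else 0)"
  shows "d (wedge vs) = contract j vs"
proof -
  interpret d: Vector_Spaces.linear scale scale d
    using assms(1) by (simp add: left_skew_derivation_def)
  have prod: "d (a * b) = d a * b + (-1) ^ i * a * d b" if "a \<in> graded {i}" for a b i
    using assms(1) that unfolding left_skew_derivation_def ext_power_conv_graded by blast
  \<comment> \<open>The product rule for \<open>1 * 1\<close> gives
    \<open>d 1 = d 1 + d 1\<close>.\<close>
  have one: "d 1 = 0"
    using prod[of "wedge []" 0 1] wedge_in_graded[of "[]" "{0}"] by simp
  have "d (\<iota> v) = scale (coord j v) 1" for v
  proof -
    have "d (\<iota> v) = (\<Sum>i\<in>{1..n}. scale (coord i v) (d (\<iota> (x i))))"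
      by (subst basis_expand) (simp add: iota_sum iota_scale d.sum d.scale)
    also have "\<dots> = (\<Sum>i\<in>{1..n}. if i = j then scale (coord i v) 1 else 0)"
      by (intro sum.cong refl) (simp add: d)
    also have "\<dots> = scale (coord j v) 1"
      by (auto simp: sum.delta coord_def)
    finally show ?thesis .
  qed
  moreover have "d (\<iota> v * b) = d (\<iota> v) * b - \<iota> v * d b" for v b
    using prod[of "\<iota> v" 1 b] wedge_in_graded[of "[v]" "{1}"] by simp
  ultimately show ?thesis
    by (induction vs) (auto simp: one A.scale_mult_left)
qed

section \<open>Partial derivatives\<close>

abbreviation pd :: "nat \<Rightarrow> 'a \<Rightarrow> 'a" where
  "pd \<equiv> ext_partial scale \<iota> n x"

text \<open>Resolves the definite description in \<open>ext_partial\<close>: contraction is a skew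
  derivation with the prescribed values, and these values determine it. All further rules for
  \<open>pd\<close> are read off from \<open>contract\<close>.\<close>

lemma linear_pd: "Vector_Spaces.linear scale scale (pd j)"
  and pd_wedge: "pd j (wedge vs) = contract j vs"
proof -
  obtain d where lin: "Vector_Spaces.linear scale scale d"
    and d: "\<And>vs. d (wedge vs) = contract j vs"
    using ex_contract by blast
  interpret d: Vector_Spaces.linear scale scale d by fact
  have skew: "left_skew_derivation scale \<iota> d"
    unfolding left_skew_derivation_def ext_power_conv_graded
  proof (intro conjI allI ballI lin)
    fix i a b
    assume "a \<in> graded {i}"
    then show "d (a * b) = d a * b + (- 1) ^ i * a * d b"
      by (induction rule: graded_induct)
        (auto simp: contract_wedge_mult[OF lin d] d.add d.scale algebra_simps A.scale_mult_left
          A.scale_mult_right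
          A.scale_right_distrib)
  qed
  moreover have "d (\<iota> (x i)) = (if i = j then 1 else 0)" if "i \<in> {1..n}" for i
    using d[of "[x i]"] that by (simp add: coord_basis)
  moreover have "e = d" if "left_skew_derivation scale \<iota> e"
    "\<forall>i\<in>{1..n}. e (\<iota> (x i)) = (if i = j then 1 else 0)" for e
  proof
    fix a
    interpret e: Vector_Spaces.linear scale scale e
      using that(1) by (simp add: left_skew_derivation_def)
    have "e (wedge vs) = d (wedge vs)" for vs
      using left_skew_derivation_unique[OF that(1)] that(2) d by simp
    then show "e a = d a"
      by (induction a rule: wedge_induct) (auto simp: e.add d.add e.scale d.scale)
  qed
  ultimately have "pd j = d"
    unfolding ext_partial_def by (intro the_equality conjI ballI) blast+
  then show "Vector_Spaces.linear scale scale (pd j)" "pd j (wedge vs) = contract j vs"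
    using lin d by auto
qed

sublocale pd: Vector_Spaces.linear scale scale "pd j" for j
  by (rule linear_pd)

lemma pd_iota: "pd j (\<iota> v) = scale (coord j v) 1"
  using pd_wedge[of j "[v]"] by simp

lemma pd_one [simp]: "pd j 1 = 0"
  using pd_wedge[of j "[]"] by simp

lemmas pd_iota_mult = contract_iota_mult[OF linear_pd pd_wedge]
  and pd_wedge_mult = contract_wedge_mult[OF linear_pd pd_wedge]

lemma pd_Ev_mult: "a \<in> Ev \<Longrightarrow> pd j (a * b) = pd j a * b + a * pd j b"
  by (induction rule: graded_induct)
    (auto simp: pd_wedge_mult pd.add pd.scale algebra_simps A.scale_mult_left A.scale_right_distrib)

lemma pd_Od_mult: "a \<in> Od \<Longrightarrow> pd j (a * b) = pd j a * b - a * pd j b"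
proof (induction rule: graded_induct)
  case (add a b)
  then show ?case by (simp add: pd.add algebra_simps)
qed (auto simp: pd_wedge_mult pd.scale pd.zero A.scale_mult_left A.scale_right_diff_distrib)

text \<open>For a word \<open>v # vs\<close> with product \<open>\<iota> v * w\<close>, the left
  side is \<open>coord j v\<close> times \<open>pd i w\<close>, minus \<open>coord i v\<close> times
  \<open>pd j w\<close>, plus \<open>\<iota> v * pd i (pd j w)\<close>; this is antisymmetric in
  \<open>i\<close> and \<open>j\<close> by induction.\<close>

lemma pd_anticommute: "pd i (pd j a) = - pd j (pd i a)"
proof (induction a rule: wedge_induct)
  case (wedge vs)
  show ?case
  proof (induction vs)
    case (Cons v vs)
    then show ?case
      by (simp add: pd_iota_mult pd.diff pd.scale algebra_simps)
  qed simp
qed (auto simp: pd.add pd.scale)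

text \<open>The set of degrees is empty for the empty word, which covers \<open>pd j 1 = 0\<close>
  without truncated subtraction.\<close>

lemma pd_wedge_in_graded: "pd j (wedge vs) \<in> graded {k. Suc k = length vs}"
proof (induction vs)
  case (Cons v vs)
  have "wedge [v] * pd j (wedge vs) \<in> graded {k. Suc k = length (v # vs)}"
    by (rule graded_mult[OF wedge_in_graded[of _ "{1}"] Cons]) auto
  then show ?case
    by (simp add: pd_iota_mult) (auto intro!: graded_diff graded_scale)
qed simp

lemma pd_in_graded:
  assumes "a \<in> graded L" "\<And>k. Suc k \<in> L \<Longrightarrow> k \<in> L'"
  shows "pd j a \<in> graded L'"
  by (rule linear_image_graded[OF linear_pd assms(1)])
    (rule graded_mono[OF _ pd_wedge_in_graded], use assms(2) in auto)

lemma pd_Od: "a \<in> Od \<Longrightarrow> pd j a \<in> Ev"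
  by (rule pd_in_graded) auto

section \<open>Basis monomials and the top degree\<close>

lemma pd_basis_wedge_notin:
  "j \<notin> set js \<Longrightarrow> set js \<subseteq> {1..n} \<Longrightarrow> pd j (wedge (map x js)) = 0"
  by (induction js) (auto simp: pd_iota_mult coord_basis)

text \<open>Reduces claims to products of basis vectors, possibly with repetitions and in any
  order.\<close>

lemma basis_graded_induct [consumes 1, case_names basis zero add scale]:
  assumes "a \<in> graded L"
    and P: "\<And>js. set js \<subseteq> {1..n} \<Longrightarrow> length js \<in> L \<Longrightarrow> P (wedge (map x js))"
    and "P 0" "\<And>a b. P a \<Longrightarrow> P b \<Longrightarrow> P (a + b)" "\<And>c a. P a \<Longrightarrow> P (scale c a)"
  shows "P a"
proof -
  have sub: "A.subspace {a. P a}"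
    using assms(3-5) by (auto simp: A.subspace_def)
  \<comment> \<open>The vectors of a word are expanded in the basis one by one from the left;
    \<open>js\<close> is the prefix already expanded.\<close>
  have "P (wedge (map x js @ vs))"
    if "set js \<subseteq> {1..n}" "length js + length vs \<in> L" for js vs
    using that
  proof (induction vs arbitrary: js)
    case Nil
    then show ?case using P by simp
  next
    case (Cons v vs)
    have "P (wedge (map x (js @ [j]) @ vs))" if "j \<in> {1..n}" for j
      using Cons.prems that by (intro Cons.IH) auto
    then have "(\<Sum>j\<in>{1..n}. scale (coord j v) (wedge (map x (js @ [j]) @ vs))) \<in> {a. P a}"
      by (intro A.subspace_sum[OF sub]) (auto intro!: assms(5))
    moreover have "wedge (map x js @ v # vs) =
        (\<Sum>j\<in>{1..n}. scale (coord j v) (wedge (map x (js @ [j]) @ vs)))"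
      by (subst basis_expand[of v])
        (simp add: wedge_append iota_sum iota_scale sum_distrib_left sum_distrib_right
          A.scale_mult_left A.scale_mult_right)
    ultimately show ?case by simp
  qed
  from this[of "[]"] have wedge: "P (wedge vs)" if "length vs \<in> L" for vs
    using that by simp
  show ?thesis
    using assms(1) by (induction rule: graded_induct) (auto intro: wedge assms(3-5))
qed

lemmas basis_wedge_induct = basis_graded_induct[OF graded_UNIV, case_names basis zero add scale]

text \<open>Pigeonhole principle: more than \<open>n\<close> basis vectors contain a
  repetition.\<close>

lemma graded_above_dim:
  assumes "a \<in> graded {n<..}"
  shows "a = 0"
  using assms
proof (induction rule: basis_graded_induct)
  case (basis js)
  have "\<not> distinct js"
    using basis card_mono[of "{1..n}" "set js"] by (auto simp: distinct_card)
  then show ?case by (intro wedge_not_distinct) (auto simp: distinct_map)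
qed auto

text \<open>Taken as a function of the whole tuple \<open>e\<close>, this is an alternating
  multilinear map; \<open>vol x\<close> is the top monomial.\<close>

definition vol :: "(nat \<Rightarrow> 'v) \<Rightarrow> 'a" where
  "vol e = wedge (map e [1..<Suc n])"

lemma vol_upd_add:
  assumes "a \<in> {1..n}"
  shows "vol (e(a := s + t)) = vol (e(a := s)) + vol (e(a := t))"
proof -
  have "a \<in> set [1..<Suc n]" using assms by auto
  then obtain ys zs where l: "[1..<Suc n] = ys @ a # zs" by (meson split_list)
  then have "distinct (ys @ a # zs)" by (metis distinct_upt)
  then have "map (e(a := r)) [1..<Suc n] = map e ys @ r # map e zs" for r
    unfolding l by auto
  then show ?thesis by (simp add: vol_def wedge_append_add)
qed

lemma vol_not_inj:
  assumes "a \<in> {1..n}" "b \<in> {1..n}" "a \<noteq> b" "e a = e b"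
  shows "vol e = 0"
proof -
  have "\<not> inj_on e (set [1..<Suc n])" using assms inj_onD[of e "set [1..<Suc n]" a b] by auto
  then show ?thesis unfolding vol_def by (intro wedge_not_distinct) (simp add: distinct_map)
qed

text \<open>Alternating maps are antisymmetric: expand the value with \<open>e a + e b\<close> in
  both places.\<close>

lemma vol_transpose:
  assumes "a \<in> {1..n}" "b \<in> {1..n}" "a \<noteq> b"
  shows "vol (e \<circ> Transposition.transpose a b) = - vol e"
proof -
  define g where "g s t = vol (e(a := s, b := t))" for s t
  have add_r: "g s (t + t') = g s t + g s t'" for s t t'
    unfolding g_def using assms by (intro vol_upd_add) auto
  have add_l: "g (s + s') t = g s t + g s' t" for s s' t
    unfolding g_def using assms vol_upd_add[of a "e(b := t)" s s']
    by (simp add: fun_upd_twist)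
  have diag: "g s s = 0" for s
    unfolding g_def using assms by (intro vol_not_inj[of a b]) auto
  have "g (e b) (e a) + g (e a) (e b) = 0"
    using diag[of "e a + e b"] unfolding add_l add_r by (simp add: diag)
  moreover have "e \<circ> Transposition.transpose a b = e(a := e b, b := e a)"
    using assms(3) by (auto simp: fun_eq_iff Transposition.transpose_def)
  ultimately show ?thesis
    by (simp add: g_def eq_neg_iff_add_eq_0)
qed

lemma vol_permute:
  assumes "p permutes {1..n}"
  shows "vol (e \<circ> p) = of_int (sign p) * vol e"
proof -
  have "finite {1..n}" by simp
  from this assms show ?thesis
  proof (induction rule: permutes_rev_induct)
    case id
    show ?case by (simp add: sign_id)
  next
    case (swap a b p)
    have "permutation p" using swap by (auto simp: permutation_permutes)
    then have "sign (p \<circ> Transposition.transpose a b) = - sign p"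
      using swap by (simp add: sign_compose permutation_swap_id sign_swap_id)
    moreover have "vol (e \<circ> (p \<circ> Transposition.transpose a b)) = - vol (e \<circ> p)"
      unfolding o_assoc using swap by (intro vol_transpose)
    ultimately show ?case by (simp only: swap.IH of_int_minus mult_minus_left)
  qed
qed

text \<open>The case split by which linear forms are tested on square-free monomials.\<close>

lemma distinct_basis_wedge_cases:
  assumes "distinct js" "set js \<subseteq> {1..n}"
  obtains (missing) j where "j \<in> {1..n}" "j \<notin> set js" "length js < n"
  | (full) "length js = n" "wedge (map x js) = vol x \<or> wedge (map x js) = - vol x"
proof (cases "set js = {1..n}")
  case False
  then have "set js \<subset> {1..n}" using assms by auto
  then obtain j where "j \<in> {1..n}" "j \<notin> set js" by blast
  moreover have "card (set js) < card {1..n}"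
    using \<open>set js \<subset> {1..n}\<close> by (intro psubset_card_mono) auto
  ultimately show ?thesis
    using missing[of j] assms(1) by (simp add: distinct_card)
next
  case True
  then have len: "length js = n"
    using assms(1) distinct_card[of js] by simp
  \<comment> \<open>List positions start at 0, the basis indices at 1.\<close>
  define p where "p i = (if i \<in> {1..n} then js ! (i - 1) else i)" for i
  have js: "js = map p [1..<Suc n]"
    by (rule nth_equalityI) (use len in \<open>auto simp: p_def \<close>)
  have "p permutes {1..n}"
  proof (rule bij_imp_permutes)
    have img: "p ` {1..n} = {1..n}"
      using True js by (metis atLeastLessThanSuc_atLeastAtMost image_set set_upt)
    moreover from img have "inj_on p {1..n}"
      by (intro eq_card_imp_inj_on) auto
    ultimately show "bij_betw p {1..n} {1..n}" by (simp add: bij_betw_def)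
  qed (auto simp: p_def)
  then have "vol (x \<circ> p) = of_int (sign p) * vol x" by (rule vol_permute)
  moreover have "vol (x \<circ> p) = wedge (map x js)" by (subst js) (simp add: vol_def)
  ultimately have w: "wedge (map x js) = of_int (sign p) * vol x" by simp
  have "wedge (map x js) = vol x \<or> wedge (map x js) = - vol x"
    unfolding w by (rule disjE[OF sign_cases[of p]]) simp_all
  then show ?thesis by (rule full[OF len])
qed

section \<open>The integral as an iterated derivative\<close>

lemma fold_pd_graded: "a \<in> graded {i} \<Longrightarrow> fold pd js a \<in> graded {k. k + length js = i}"
proof (induction js arbitrary: a i)
  case (Cons j js)
  show ?case
  proof (cases i)
    case 0
    have "pd j a \<in> graded {}" by (rule pd_in_graded[OF Cons.prems]) (auto simp: 0)
    then have "pd j a = 0" by (rule graded_empty)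
    moreover have "fold pd js 0 = 0" by (induction js) (auto simp: pd.zero)
    ultimately show ?thesis by simp
  next
    case (Suc k)
    have "pd j a \<in> graded {k}" by (rule pd_in_graded[OF Cons.prems]) (auto simp: Suc)
    from Cons.IH[OF this] show ?thesis by (simp add: Suc)
  qed
qed simp

text \<open>\<open>fold\<close> differentiates first by the head of the list, which is the leftmost
  factor, so no sign arises.\<close>

lemma fold_pd_basis_wedge:
  "distinct js \<Longrightarrow> set js \<subseteq> {1..n} \<Longrightarrow> fold pd js (wedge (map x js)) = 1"
proof (induction js)
  case (Cons j js)
  then have "pd j (\<iota> (x j) * wedge (map x js)) = wedge (map x js)"
    by (subst pd_iota_mult) (auto simp: coord_basis pd_basis_wedge_notin)
  then show ?case using Cons by simp
qed simp

lemma linear_fold_pd: "Vector_Spaces.linear scale scale (fold pd js)"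
proof (induction js)
  case Nil
  show ?case using A.linear_id by (simp add: id_def)
next
  case (Cons j js)
  show ?case
    using Vector_Spaces.linear_compose[OF linear_pd Cons] by (simp add: comp_def)
qed

abbreviation integral :: "'a \<Rightarrow> 'k" where
  "integral \<equiv> ext_integral scale \<iota> n x"

lemma linear_integral: "Vector_Spaces.linear scale (*) integral"
  and integral_low: "i < n \<Longrightarrow> a \<in> graded {i} \<Longrightarrow> integral a = 0"
  and integral_vol: "integral (vol x) = 1"
proof -
  define Q where "Q f \<longleftrightarrow> Vector_Spaces.linear scale (*) f \<and>
    (\<forall>i<n. \<forall>a\<in>ext_power scale \<iota> i. f a = 0) \<and>
    f (prod_list (map (\<lambda>i. \<iota> (x i)) [1..<Suc n])) = 1" for f :: "'a \<Rightarrow> 'k"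
  have vol: "prod_list (map (\<lambda>i. \<iota> (x i)) [1..<Suc n]) = vol x"
    by (simp add: vol_def wedge_def comp_def)
  \<comment> \<open>Berezin's description of the integral: differentiate by all variables and take
    the constant term.\<close>
  let ?f = "aug \<circ> fold pd [1..<Suc n]"
  have Qf: "Q ?f"
    unfolding Q_def vol
  proof (intro conjI allI impI ballI)
    show "Vector_Spaces.linear scale (*) ?f"
      by (rule Vector_Spaces.linear_compose[OF linear_fold_pd linear_aug])
    fix i a
    assume "i < n" "a \<in> ext_power scale \<iota> i"
    then have "fold pd [1..<Suc n] a \<in> graded {}"
      using fold_pd_graded[of a i "[1..<Suc n]"]
      by (auto simp: ext_power_conv_graded  elim!: graded_mono[rotated])
    then show "?f a = 0" using graded_empty by fastforce
  next
    show "?f (vol x) = 1"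
      by (simp add: vol_def fold_pd_basis_wedge)
  qed
  have unique: "f = g" if "Q f" "Q g" for f g
  proof
    fix a
    interpret f: Vector_Spaces.linear scale "(*)" f using that by (simp add: Q_def)
    interpret g: Vector_Spaces.linear scale "(*)" g using that by (simp add: Q_def)
    have low: "f a = 0" "g a = 0" if "i < n" "a \<in> graded {i}" for a i
      using \<open>Q f\<close> \<open>Q g\<close> that unfolding Q_def ext_power_conv_graded by blast+
    show "f a = g a"
    proof (induction a rule: basis_wedge_induct)
      case (basis js)
      show ?case
      proof (cases "distinct js")
        case False
        then have "wedge (map x js) = 0" by (intro wedge_not_distinct) (auto simp: distinct_map)
        then show ?thesis by (simp add: f.zero g.zero)
      next
        case True
        from this basis(1) show ?thesis
        proof (cases rule: distinct_basis_wedge_cases)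
          case missing
          then show ?thesis
            using low[of "length js" "wedge (map x js)"] wedge_in_graded[of "map x js" "{length js}"]
            by simp
        next
          case full
          from full(2) show ?thesis using that by (auto simp: Q_def vol f.neg g.neg)
        qed
      qed
    qed (auto simp: f.add g.add f.scale g.scale f.zero g.zero)
  qed
  have "Q (The Q)"
    by (rule theI[of Q, OF Qf]) (rule unique[OF _ Qf])
  moreover have "The Q = integral"
    by (simp only: ext_integral_def Q_def[abs_def])
  ultimately have "Q integral" by simp
  then show "Vector_Spaces.linear scale (*) integral"
    "i < n \<Longrightarrow> a \<in> graded {i} \<Longrightarrow> integral a = 0" "integral (vol x) = 1"
    unfolding Q_def vol ext_power_conv_graded by blast+
qed

lemma integral_add: "integral (a + b) = integral a + integral b"
  and integral_scale: "integral (scale c a) = c * integral a"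
  and integral_zero [simp]: "integral 0 = 0"
  and integral_neg: "integral (- a) = - integral a"
  and integral_diff: "integral (a - b) = integral a - integral b"
  and integral_sum: "integral (sum f S) = (\<Sum>i\<in>S. integral (f i))"
proof -
  interpret integral: Vector_Spaces.linear scale "(*)" integral by (rule linear_integral)
  show "integral (a + b) = integral a + integral b" "integral (scale c a) = c * integral a"
    "integral 0 = 0" "integral (- a) = - integral a" "integral (a - b) = integral a - integral b"
    "integral (sum f S) = (\<Sum>i\<in>S. integral (f i))"
    by (rule integral.add integral.scale integral.zero integral.neg integral.diff integral.sum)+
qed

lemma integral_graded:
  assumes "a \<in> graded L" "n \<notin> L"
  shows "integral a = 0"
  using assms(1)
proof (induction rule: graded_induct)
  case (wedge vs)
  then consider "length vs < n" | "length vs > n" using assms(2) by fastforce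
  then show ?case
  proof cases
    case 2
    then have "wedge vs = 0" by (intro graded_above_dim) auto
    then show ?thesis by simp
  qed (auto intro: integral_low)
qed (auto simp: integral_add integral_scale)

text \<open>A derivative has a component of degree \<open>n\<close> only if it comes from degree
  \<open>n + 1\<close>, where everything is 0.\<close>

lemma integral_pd [simp]: "integral (pd j a) = 0"
proof (induction a rule: wedge_induct)
  case (wedge vs)
  show ?case
  proof (cases "length vs = Suc n")
    case True
    then have "wedge vs = 0" by (intro graded_above_dim) auto
    then show ?thesis by (simp add: pd.zero)
  next
    case False
    then show ?thesis by (intro integral_graded[OF pd_wedge_in_graded]) auto
  qed
qed (auto simp: pd.add pd.scale pd.zero integral_add integral_scale)

text \<open>A basis monomial \<open>w\<close> that omits \<open>x\<^sub>j\<close> is the derivative \<open>\<partial>\<^sub>j (x\<^sub>j w)\<close>, so a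
  linear form that kills all derivatives is determined by its value on the top monomial.\<close>

lemma functional_eq_integral:
  assumes "Vector_Spaces.linear scale (*) f"
    and f_pd: "\<And>j a. j \<in> {1..n} \<Longrightarrow> f (pd j a) = 0"
  shows "f a = f (vol x) * integral a"
proof -
  interpret f: Vector_Spaces.linear scale "(*)" f by fact
  show ?thesis
  proof (induction a rule: basis_wedge_induct)
    case (basis js)
    show ?case
    proof (cases "distinct js")
      case False
      then have "wedge (map x js) = 0" by (intro wedge_not_distinct) (auto simp: distinct_map)
      then show ?thesis by (simp add: f.zero)
    next
      case True
      from this basis(1) show ?thesis
      proof (cases rule: distinct_basis_wedge_cases)
        case (missing j)
        then have "pd j (\<iota> (x j) * wedge (map x js)) = wedge (map x js)"
          using basis by (simp add: pd_iota_mult coord_basis pd_basis_wedge_notin)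
        then have "f (wedge (map x js)) = 0" by (metis f_pd missing(1))
        moreover have "integral (wedge (map x js)) = 0"
          using missing by (intro integral_low[of "length js"]) auto
        ultimately show ?thesis by simp
      next
        case full
        from full(2) show ?thesis by (auto simp: f.neg integral_vol integral_neg)
      qed
    qed
  qed (auto simp: f.add f.scale f.zero integral_add integral_scale distrib_left)
qed

section \<open>Non-degeneracy of the form, and units\<close>

lemma vol_mult: "vol x * a = scale (aug a) (vol x)"
proof -
  \<comment> \<open>Removing the constant term leaves positive degrees, which the top monomial
    pushes above degree \<open>n\<close>.\<close>
  have "vol x * (a - scale (aug a) 1) \<in> graded {n<..}"
    unfolding vol_def
    by (rule graded_mult[OF wedge_in_graded[of _ "{n}"] diff_aug_in_graded]) auto
  then have "vol x * (a - scale (aug a) 1) = 0" by (rule graded_above_dim)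
  then show ?thesis by (simp add: right_diff_distrib A.scale_mult_right)
qed

text \<open>Multiplying \<open>a\<close> by suitable variables leads to a non-zero multiple that
  every variable annihilates; such an element is a scalar multiple of the top monomial.\<close>

lemma integral_nondegenerate_left:
  assumes "a \<noteq> 0"
  shows "\<exists>w. integral (w * a) \<noteq> 0"
proof -
  \<comment> \<open>The next variable is multiplied in exactly when it does not already annihilate
    \<open>w * a\<close>.\<close>
  have "\<exists>w. w * a \<noteq> 0 \<and> (\<forall>j\<in>{1..k}. \<iota> (x j) * (w * a) = 0)" for k
  proof (induction k)
    case 0
    show ?case using assms by (intro exI[of _ 1]) auto
  next
    case (Suc k)
    then obtain w where w: "w * a \<noteq> 0" "\<And>j. j \<in> {1..k} \<Longrightarrow> \<iota> (x j) * (w * a) = 0" by blast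
    show ?case
    proof (cases "\<iota> (x (Suc k)) * (w * a) = 0")
      case True
      then show ?thesis using w by (intro exI[of _ w]) (auto simp: atLeastAtMostSuc_conv)
    next
      case False
      have "\<iota> (x j) * (\<iota> (x (Suc k)) * w * a) = 0" if "j \<in> {1..Suc k}" for j
      proof (cases "j = Suc k")
        case True
        then show ?thesis by (simp add: iota_square flip: mult.assoc)
      next
        case False
        have "\<iota> (x j) * (\<iota> (x (Suc k)) * w * a) = (\<iota> (x j) * \<iota> (x (Suc k))) * (w * a)"
          by (simp add: mult.assoc)
        also have "\<dots> = - (\<iota> (x (Suc k)) * (\<iota> (x j) * (w * a)))"
          by (subst iota_anticommute) (simp add: mult.assoc)
        finally show ?thesis using False that w(2)[of j] by simp
      qed
      then show ?thesis using False by (intro exI[of _ "\<iota> (x (Suc k)) * w"]) (auto simp: mult.assoc)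
    qed
  qed
  then obtain w where w: "w * a \<noteq> 0" "\<And>j. j \<in> {1..n} \<Longrightarrow> \<iota> (x j) * (w * a) = 0" by blast
  define b where "b = w * a"
  \<comment> \<open>Differentiating \<open>\<iota> (x j) * b = 0\<close> splits the variable off on
    the left; doing so for all variables in turn exhibits \<open>b\<close> as a multiple of
    \<open>vol x\<close>.\<close>
  have b: "b = \<iota> (x j) * pd j b" if "j \<in> {1..n}" for j
  proof -
    have "pd j (\<iota> (x j) * b) = 0" using w(2)[OF that] by (simp add: b_def pd.zero)
    then have "b - \<iota> (x j) * pd j b = 0" using that by (simp add: pd_iota_mult coord_basis)
    then show ?thesis by (rule right_minus_eq[THEN iffD1])
  qed
  have "\<exists>c. b = wedge (map x js) * c" if "distinct js" "set js \<subseteq> {1..n}" for js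
    using that
  proof (induction js)
    case (Cons j js)
    then obtain c where c: "b = wedge (map x js) * c" by auto
    have "b = \<iota> (x j) * pd j b"
      using Cons.prems by (intro b) auto
    also have "\<dots> = \<iota> (x j) * pd j (wedge (map x js) * c)"
      by (simp only: c[symmetric])
    also have "\<dots> = \<iota> (x j) * ((-1) ^ length js * wedge (map x js) * pd j c)"
      using Cons.prems by (subst pd_wedge_mult) (simp add: pd_basis_wedge_notin)
    also have "\<dots> = wedge (map x (j # js)) * ((-1) ^ length js * pd j c)"
      by (cases "even (length js)") (auto simp: mult.assoc)
    finally show ?case by blast
  qed simp
  from this[of "[1..<Suc n]"] obtain c where "b = vol x * c" by (auto simp: vol_def)
  then have "b = scale (aug c) (vol x)" by (simp add: vol_mult)
  then have "integral b \<noteq> 0" using w(1) by (auto simp: b_def integral_scale integral_vol)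
  then show ?thesis unfolding b_def by blast
qed

text \<open>Carries the previous lemma to the other side. Against a monomial of given length the
  integral sees only one parity of \<open>a\<close>, so the even and the odd part are each
  orthogonal to everything; each commutes with monomials up to sign.\<close>

lemma integral_nondegenerate:
  assumes "\<And>b. integral (a * b) = 0"
  shows "a = 0"
proof -
  obtain e d where e: "e \<in> Ev" and d: "d \<in> Od" and a: "a = e + d"
    using Ev_Od_decompose by blast
  have parity: "integral (e * wedge vs) = 0 \<and> integral (d * wedge vs) = 0" for vs
  proof (cases "even (length vs + n)")
    case True
    have "integral (d * wedge vs) = 0"
      by (rule integral_graded[OF graded_mult[OF d wedge_in_graded[of vs "{length vs}"],
              of "{i. odd (i + length vs)}"]])
        (use True in auto)
    then show ?thesis
      using assms[of "wedge vs"] by (simp add: a distrib_right integral_add)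
  next
    case False
    have "integral (e * wedge vs) = 0"
      by (rule integral_graded[OF graded_mult[OF e wedge_in_graded[of vs "{length vs}"],
              of "{i. even (i + length vs)}"]])
        (use False in auto)
    then show ?thesis
      using assms[of "wedge vs"] by (simp add: a distrib_right integral_add)
  qed
  have "wedge vs * d = (-1) ^ length vs * (d * wedge vs)" for vs
    using d
  proof (induction rule: graded_induct)
    case (wedge ws)
    then show ?case by (subst wedge_commute) (cases "even (length vs)"; simp)
  qed (auto simp: algebra_simps A.scale_mult_left A.scale_mult_right)
  then have "integral (wedge vs * d) = 0" for vs
    using parity[of vs] by (cases "even (length vs)") (auto simp: integral_neg)
  then have "integral (w * d) = 0" for w
    by (induction w rule: wedge_induct)
      (auto simp: integral_add integral_scale distrib_right A.scale_mult_left)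
  then have "d = 0" using integral_nondegenerate_left by blast
  moreover have "integral (w * e) = 0" for w
    by (induction w rule: wedge_induct)
      (use parity Ev_commute[OF e] in
        \<open>auto simp: integral_add integral_scale distrib_right A.scale_mult_left\<close>)
  then have "e = 0" using integral_nondegenerate_left by blast
  ultimately show ?thesis by (simp add: a)
qed

text \<open>Up to the factor \<open>aug a\<close> the element is \<open>1 - N\<close> with
  \<open>N\<close> of positive degree, hence nilpotent; the geometric series inverts it.\<close>

lemma aug_nonzero_right_inverse:
  assumes "aug a \<noteq> 0"
  shows "\<exists>b. a * b = 1"
proof -
  define N where "N = 1 - scale (1 / aug a) a"
  have "aug (N + scale (1 / aug a) a) = 1" by (simp add: N_def)
  then have "aug N = 0" using assms by (simp add: aug_add aug_scale)
  then have N: "N \<in> graded {1..}" using diff_aug_in_graded[of N] by simp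
  have "N ^ k \<in> graded {k..}" for k
  proof (induction k)
    case 0
    show ?case using wedge_in_graded[of "[]" "{0..}"] by simp
  next
    case (Suc k)
    show ?case unfolding power_Suc by (rule graded_mult[OF N Suc]) auto
  qed
  from this[of "Suc n"] have nilp: "N ^ Suc n = 0"
    by (intro graded_above_dim) (auto elim!: graded_mono[rotated])
  have geom: "(1 - N) * (\<Sum>i<k. N ^ i) = 1 - N ^ k" for k
    by (induction k) (simp_all add: distrib_left, simp add: left_diff_distrib)
  have "scale (1 / aug a) a * (\<Sum>i<Suc n. N ^ i) = 1"
    using geom[of "Suc n"] nilp by (simp add: N_def)
  then have "a * scale (1 / aug a) (\<Sum>i<Suc n. N ^ i) = 1"
    by (simp add: A.scale_mult_left A.scale_mult_right)
  then show ?thesis by blast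
qed

text \<open>An odd element has no constant term, and the coefficient of \<open>x j\<close> in its
  linear part is the constant term of its \<open>j\<close>-th derivative.\<close>

lemma Od_leading_part:
  assumes "a \<in> Od"
  shows "a - (\<Sum>j\<in>{1..n}. scale (aug (pd j a)) (\<iota> (x j))) \<in> graded {2..}"
  using assms
proof (induction rule: graded_induct)
  case (wedge vs)
  show ?case
  proof (cases "length vs = 1")
    case True
    then obtain v where vs: "vs = [v]" by (auto simp: length_Suc_conv One_nat_def)
    have "(\<Sum>j\<in>{1..n}. scale (aug (pd j (wedge vs))) (\<iota> (x j))) =
        \<iota> (\<Sum>j\<in>{1..n}. scaleV (coord j v) (x j))"
      by (simp add: vs pd_iota aug_scale iota_sum iota_scale)
    then show ?thesis by (simp add: vs flip: basis_expand)
  next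
    case False
    then have len: "length vs \<ge> 2" using wedge by (cases "length vs") (auto simp: One_nat_def)
    have "aug (pd j (wedge vs)) = 0" for j
      by (rule aug_graded[OF pd_wedge_in_graded]) (use len in auto)
    then show ?thesis using len by auto
  qed
next
  case (add a b)
  then show ?case
    using graded_add[OF add(3,4)]
    by (simp add: pd.add aug_add A.scale_left_distrib sum.distrib algebra_simps)
next
  case (scale c a)
  then show ?case
    using graded_scale[OF scale(2), of c]
    by (simp add: pd.scale aug_scale A.scale_right_diff_distrib A.scale_sum_right)
qed (simp add: pd.zero)

text \<open>A linear substitution scales the top monomial by its determinant: in the multilinear
  expansion, repeated indices give 0 and permutations give a sign.\<close>

lemma vol_expand:
  "vol (\<lambda>i. \<Sum>j\<in>{1..n}. scaleV (c i j) (x j)) =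
    scale (\<Sum>p | p permutes {1..n}. of_int (sign p) * prod_list (map (\<lambda>i. c i (p i)) [1..<Suc n])) (vol x)"
proof -
  define h where "h f = scale (prod_list (map (\<lambda>i. c i (f i)) [1..<Suc n])) (vol (x \<circ> f))"
    for f :: "nat \<Rightarrow> nat"
  have prod: "prod_list (map (\<lambda>i. scale (a i) (b i)) l) = scale (prod_list (map a l)) (prod_list (map b l))"
    for a :: "nat \<Rightarrow> 'k" and b :: "nat \<Rightarrow> 'a" and l
    by (induction l) (auto simp: A.scale_mult_left A.scale_mult_right mult.commute)
  have "vol (\<lambda>i. \<Sum>j\<in>{1..n}. scaleV (c i j) (x j)) =
      prod_list (map (\<lambda>i. \<Sum>j\<in>{1..n}. scale (c i j) (\<iota> (x j))) [1..<Suc n])"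
    by (simp add: vol_def wedge_def comp_def iota_sum iota_scale)
  also have "\<dots> = (\<Sum>f\<in>PiE {1..n} (\<lambda>_. {1..n}). h f)"
    by (subst prod_list_sum_distrib) (simp_all add: h_def vol_def wedge_def prod comp_def)
  also have "\<dots> = (\<Sum>p | p permutes {1..n}. h p)"
  proof (rule sum_PiE_inj_eq_sum_permutes)
    fix f :: "nat \<Rightarrow> nat"
    assume "\<not> inj_on f {1..n}"
    then obtain a b where "a \<in> {1..n}" "b \<in> {1..n}" "a \<noteq> b" "f a = f b"
      by (auto simp: inj_on_def)
    then have "vol (x \<circ> f) = 0" by (intro vol_not_inj[of a b]) auto
    then show "h f = 0" by (simp add: h_def)
  next
    fix p
    have "map (\<lambda>i. c i (restrict p {1..n} i)) [1..<Suc n] = map (\<lambda>i. c i (p i)) [1..<Suc n]"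
      "map (x \<circ> restrict p {1..n}) [1..<Suc n] = map (x \<circ> p) [1..<Suc n]"
      by (auto intro!: map_cong)
    then show "h (restrict p {1..n}) = h p"
      unfolding h_def vol_def by (simp only:)
  qed simp
  also have "\<dots> = (\<Sum>p | p permutes {1..n}.
      scale (of_int (sign p) * prod_list (map (\<lambda>i. c i (p i)) [1..<Suc n])) (vol x))"
  proof (rule sum.cong)
    fix p
    assume "p \<in> {p. p permutes {1..n}}"
    then have "vol (x \<circ> p) = of_int (sign p) * vol x" by (intro vol_permute) simp
    then show "h p = scale (of_int (sign p) * prod_list (map (\<lambda>i. c i (p i)) [1..<Suc n])) (vol x)"
      unfolding h_def by (cases p rule: sign_cases) (simp_all)
  qed simp
  finally show ?thesis by (simp add: A.scale_sum_left)
qed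

text \<open>Even factors are central, so one of them can be moved to the front. Replacing it by
  \<open>1\<close> instead of deleting it keeps the index list fixed.\<close>

lemma prod_list_extract:
  assumes "l \<in> set is" "distinct is" "\<And>i. i \<in> set is \<Longrightarrow> f i \<in> Ev"
  shows "prod_list (map f is) = f l * prod_list (map (f(l := 1)) is)"
  using assms
proof (induction "is")
  case (Cons i "is")
  show ?case
  proof (cases "i = l")
    case True
    then have "map (f(l := 1)) is = map f is" using Cons.prems by auto
    then show ?thesis
      by (simp only: True list.map(2) prod_list.Cons fun_upd_same mult_1_left)
  next
    case False
    then have "prod_list (map f is) = f l * prod_list (map (f(l := 1)) is)"
      using Cons.prems by (intro Cons.IH) auto
    then show ?thesis
      using False Ev_commute[OF Cons.prems(3)[of i], of "f l"] by (simp del: fun_upd_apply add: fun_upd_other flip: mult.assoc)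
  qed
qed simp

lemma pd_prod_list:
  assumes "distinct is" "\<And>i. i \<in> set is \<Longrightarrow> f i \<in> Ev"
  shows "pd j (prod_list (map f is)) = (\<Sum>l\<in>set is. pd j (f l) * prod_list (map (f(l := 1)) is))"
  using assms
proof (induction "is")
  case (Cons i "is")
  have i: "f i \<in> Ev" "i \<notin> set is" using Cons.prems by auto
  have "pd j (prod_list (map f (i # is))) =
      pd j (f i) * prod_list (map f is) + f i * (\<Sum>l\<in>set is. pd j (f l) * prod_list (map (f(l := 1)) is))"
    using Cons i by (simp add: pd_Ev_mult del: fun_upd_apply)
  also have "f i * (\<Sum>l\<in>set is. pd j (f l) * prod_list (map (f(l := 1)) is)) =
      (\<Sum>l\<in>set is. pd j (f l) * prod_list (map (f(l := 1)) (i # is)))"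
    unfolding sum_distrib_left
  proof (rule sum.cong)
    fix l
    assume "l \<in> set is"
    then have "l \<noteq> i" using i by auto
    then show "f i * (pd j (f l) * prod_list (map (f(l := 1)) is)) =
        pd j (f l) * prod_list (map (f(l := 1)) (i # is))"
      using Ev_commute[OF i(1), of "pd j (f l)"]
      by (simp del: fun_upd_apply add: fun_upd_other flip: mult.assoc)
  qed simp
  also have "prod_list (map f is) = prod_list (map (f(i := 1)) (i # is))"
    using i by (auto intro!: arg_cong[where f = prod_list])
  finally show ?case using i by (simp del: fun_upd_apply)
qed simp

end

subsection \<open>Odd automorphisms\<close>

locale odd_automorphism = exterior_basis scaleV scale \<iota> n x
  for scaleV :: "'k::field \<Rightarrow> 'v::ab_group_add \<Rightarrow> 'v"
    and scale :: "'k \<Rightarrow> 'a::ring_1 \<Rightarrow> 'a"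
    and \<iota> :: "'v \<Rightarrow> 'a"
    and n :: nat and x :: "nat \<Rightarrow> 'v" +
  fixes u :: "'a \<Rightarrow> 'a"
  assumes u: "u \<in> Aut_odd scale \<iota>"
    and two: "(2::'k) \<noteq> 0"
begin

sublocale u: Vector_Spaces.linear scale scale u
  using u by (simp add: Aut_odd_def algebra_automorphism_def algebra_endomorphism_def)

lemma u_one [simp]: "u 1 = 1"
  and u_mult: "u (a * b) = u a * u b"
  and bij_u: "bij u"
  and u_iota: "u (\<iota> w) \<in> Od"
proof -
  have "u ` range \<iota> \<subseteq> Od" using u ext_odd_subset_graded by (auto simp: Aut_odd_def)
  then show "u (\<iota> w) \<in> Od" by blast
qed (use u in \<open>auto simp: Aut_odd_def algebra_automorphism_def algebra_endomorphism_def\<close>)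

abbreviation "v \<equiv> inv u"

lemma v_u [simp]: "v (u a) = a" and u_v [simp]: "u (v a) = a"
  using bij_u by (simp_all add: bij_is_inj inv_f_f bij_is_surj surj_f_inv_f)

lemma v_eqI: "u b = a \<Longrightarrow> v a = b"
  using v_u by blast

lemma v_mult: "v (a * b) = v a * v b"
  by (rule v_eqI) (simp add: u_mult)

sublocale v: Vector_Spaces.linear scale scale v
  by unfold_locales (auto intro!: v_eqI simp: u.add u.scale)

lemma u_wedge: "u (wedge vs) \<in> graded {i. even i = even (length vs)}"
proof (induction vs)
  case (Cons w vs)
  show ?case unfolding wedge_Cons u_mult by (rule graded_mult[OF u_iota Cons]) auto
qed auto

lemma u_Ev: "a \<in> Ev \<Longrightarrow> u a \<in> Ev"
  and u_Od: "a \<in> Od \<Longrightarrow> u a \<in> Od"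
  by (rule linear_image_graded[OF u.linear_axioms], assumption,
      rule graded_mono[OF _ u_wedge], auto)+

text \<open>\<open>u\<close> respects parity, so it sends the odd component of \<open>v a\<close> to
  an element that is both even and odd, hence 0.\<close>

lemma v_Ev:
  assumes "a \<in> Ev"
  shows "v a \<in> Ev"
proof -
  obtain e d where ed: "e \<in> Ev" "d \<in> Od" "v a = e + d"
    using Ev_Od_decompose by blast
  have "a = u e + u d" using arg_cong[OF ed(3), of u] by (simp add: u.add)
  then have "u d = a - u e" by simp
  then have "u d \<in> Ev" using assms ed u_Ev graded_diff by metis
  then have "u d = 0" using u_Od[OF ed(2)] Ev_Int_Od by blast
  then have "d = 0" using v_u[of d] v.zero by simp
  then show ?thesis using ed by simp
qed

lemma aug_u: "aug (u a) = aug a"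
proof (induction a rule: wedge_induct)
  case (wedge vs)
  show ?case by (cases vs) (auto simp: u_mult aug_mult aug_graded[OF u_iota] aug_wedge simp flip: wedge_Cons, simp add: u_mult aug_mult aug_graded[OF u_iota])
qed (auto simp: u.add u.scale u.zero aug_add aug_scale)

lemma aug_v: "aug (v a) = aug a"
  using aug_u[of "v a"] by simp

section \<open>The Jacobian matrix and the chain rule\<close>

definition M :: "nat \<Rightarrow> nat \<Rightarrow> 'a" where
  "M k l = pd l (u (\<iota> (x k)))"

lemma M_Ev: "M k l \<in> Ev"
  unfolding M_def by (intro pd_Od u_iota)

text \<open>Both sides satisfy the same skew product rule along \<open>u\<close>, because
  \<open>u (\<iota> w)\<close> is odd and the entries of \<open>M\<close> are central; on single
  vectors they agree by linearity.\<close>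

lemma chain_rule: "pd l (u a) = (\<Sum>k\<in>{1..n}. M k l * u (pd k a))"
proof (induction a rule: wedge_induct)
  case (wedge vs)
  show ?case
  proof (induction vs)
    case Nil
    show ?case by (simp add: u.zero)
  next
    case (Cons w vs)
    have "pd l (u (\<iota> w)) = pd l (u (\<iota> (\<Sum>k\<in>{1..n}. scaleV (coord k w) (x k))))"
      using basis_expand by simp
    also have "\<dots> = (\<Sum>k\<in>{1..n}. scale (coord k w) (M k l))"
      by (simp add: iota_sum iota_scale u.sum u.scale pd.sum pd.scale M_def)
    finally have w: "pd l (u (\<iota> w)) = \<dots>" .
    have "pd l (u (wedge (w # vs))) =
        (\<Sum>k\<in>{1..n}. scale (coord k w) (M k l)) * u (wedge vs) -
        u (\<iota> w) * (\<Sum>k\<in>{1..n}. M k l * u (pd k (wedge vs)))"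
      using Cons by (simp add: u_mult pd_Od_mult[OF u_iota] w)
    also have "\<dots> = (\<Sum>k\<in>{1..n}. M k l * u (pd k (wedge (w # vs))))"
      unfolding sum_distrib_left sum_distrib_right sum_subtractf[symmetric]
    proof (rule sum.cong)
      fix k
      have "u (\<iota> w) * (M k l * u (pd k (wedge vs))) = M k l * (u (\<iota> w) * u (pd k (wedge vs)))"
        using Ev_commute[OF M_Ev, of k l "u (\<iota> w)"] by (simp flip: mult.assoc)
      then show "scale (coord k w) (M k l) * u (wedge vs) - u (\<iota> w) * (M k l * u (pd k (wedge vs))) =
          M k l * u (pd k (wedge (w # vs)))"
        by (simp add: pd_iota_mult u.diff u.scale u_mult right_diff_distrib
            A.scale_mult_left A.scale_mult_right)
    qed simp
    finally show ?case .
  qed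
qed (simp_all add: u.zero u.add u.scale pd.zero pd.add pd.scale distrib_left sum.distrib
    A.scale_mult_right A.scale_sum_right)

text \<open>The partial derivative with respect to the new variable
  \<open>u (\<iota> (x k))\<close>.\<close>

definition T :: "nat \<Rightarrow> 'a \<Rightarrow> 'a" where
  "T k a = u (pd k (v a))"

lemma pd_conv_T: "pd l a = (\<Sum>k\<in>{1..n}. M k l * T k a)"
  using chain_rule[of l "v a"] by (simp add: T_def)

lemma T_Ev_mult: "a \<in> Ev \<Longrightarrow> T k (a * b) = T k a * b + a * T k b"
  by (simp add: T_def v_mult pd_Ev_mult[OF v_Ev] u.add u_mult)

section \<open>Determinants with one row replaced\<close>

definition cof :: "nat \<Rightarrow> (nat \<Rightarrow> nat) \<Rightarrow> 'a" where
  "cof l p = prod_list (map ((\<lambda>i. M i (p i))(l := 1)) [1..<Suc n])"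

text \<open>For \<open>l\<close> in \<open>{1..n}\<close>, the determinant of \<open>M\<close> with
  row \<open>l\<close> replaced by \<open>r\<close>. With the entry of \<open>r\<close> in front it
  is linear in \<open>r\<close> for coefficients on the left, including the odd ones that arise in
  \<open>piola\<close>.\<close>

definition row_det :: "nat \<Rightarrow> (nat \<Rightarrow> 'a) \<Rightarrow> 'a" where
  "row_det l r = (\<Sum>p | p permutes {1..n}. of_int (sign p) * (r (p l) * cof l p))"

abbreviation "jac \<equiv> leibniz_det n M"

lemma of_int_Ev: "of_int (sign p) \<in> Ev"
  by (rule disjE[OF sign_cases[of p]]) (auto intro: graded_neg)

lemma jac_Ev: "jac \<in> Ev"
  unfolding leibniz_det_def
  by (intro graded_sum Ev_mult of_int_Ev Ev_prod_list) (auto simp: M_Ev)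

lemma row_det_self: "l \<in> {1..n} \<Longrightarrow> row_det l (M l) = jac"
  unfolding row_det_def leibniz_det_def cof_def
  by (intro sum.cong refl, subst prod_list_extract[of l]) (auto simp: M_Ev)

text \<open>Two rows are equal, so composing the permutation with the swap of \<open>k\<close> and
  \<open>l\<close> pairs opposite terms. The sum equals its negative, and here the characteristic
  enters.\<close>

lemma row_det_other:
  assumes "l \<in> {1..n}" "k \<in> {1..n}" "k \<noteq> l"
  shows "row_det l (M k) = 0"
proof -
  let ?t = "Transposition.transpose k l"
  define h where "h p = of_int (sign p) * (M k (p l) * cof l p)" for p
  \<comment> \<open>The term without the factors of both rows \<open>k\<close> and \<open>l\<close>,
    hence unchanged by the swap.\<close>
  define r where "r p = prod_list (map ((\<lambda>i. M i (p i))(l := 1, k := 1)) [1..<Suc n])" for p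
  have cof: "cof l p = M k (p k) * r p" for p
    unfolding cof_def r_def
    using assms by (subst prod_list_extract[of k]) (auto simp: M_Ev)
  have r: "r (p \<circ> ?t) = r p" for p
    unfolding r_def by (intro arg_cong[where f = prod_list] map_cong)
      (auto simp: Transposition.transpose_def)
  have "sum h {p. p permutes {1..n}} = (\<Sum>p | p permutes {1..n}. - h p)"
  proof (rule sum.reindex_bij_witness[where i = "\<lambda>p. p \<circ> ?t" and j = "\<lambda>p. p \<circ> ?t"])
    fix p
    assume "p \<in> {p. p permutes {1..n}}"
    then have p: "p permutes {1..n}" by simp
    have t: "?t permutes {1..n}" using assms by (intro permutes_swap_id) auto
    show "p \<circ> ?t \<in> {p. p permutes {1..n}}"
      using permutes_compose[OF t p] by simp
    then show "p \<circ> ?t \<in> {p. p permutes {1..n}}" .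
    show "p \<circ> ?t \<circ> ?t = p" by (simp add: fun_eq_iff)
    then show "p \<circ> ?t \<circ> ?t = p" .
    have "permutation p" using p by (auto simp: permutation_permutes)
    then have "sign (p \<circ> ?t) = - sign p"
      using assms by (simp add: sign_compose permutation_swap_id sign_swap_id)
    moreover have "M k (p k) * (M k (p l) * r p) = M k (p l) * (M k (p k) * r p)"
      using Ev_commute[OF M_Ev, of k "p k" "M k (p l)"] by (simp flip: mult.assoc)
    ultimately show "- h (p \<circ> ?t) = h p"
      using assms by (simp add: h_def cof r)
  qed
  then have "row_det l (M k) = - row_det l (M k)"
    by (simp add: row_det_def h_def sum_negf)
  then have "row_det l (M k) + row_det l (M k) = 0" by (simp add: eq_neg_iff_add_eq_0)
  then have "scale 2 (row_det l (M k)) = 0"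
    using A.scale_left_distrib[of 1 1 "row_det l (M k)"] by simp
  then show ?thesis using two by simp
qed

lemma row_det_lincomb:
  "row_det l (\<lambda>m. \<Sum>k\<in>K. c k * r k m) = (\<Sum>k\<in>K. c k * row_det l (r k))"
proof -
  have "row_det l (\<lambda>m. \<Sum>k\<in>K. c k * r k m) =
      (\<Sum>p | p permutes {1..n}. \<Sum>k\<in>K. c k * (of_int (sign p) * (r k (p l) * cof l p)))"
    unfolding row_det_def sum_distrib_left sum_distrib_right
    by (intro sum.cong refl)
      (metis Ev_commute[OF of_int_Ev] mult.assoc)
  also have "\<dots> = (\<Sum>k\<in>K. c k * row_det l (r k))"
    by (subst sum.swap) (simp add: row_det_def sum_distrib_left)
  finally show ?thesis .
qed

lemma pd_jac: "pd j jac = (\<Sum>l\<in>{1..n}. row_det l (\<lambda>m. pd j (M l m)))"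
proof -
  have sgn: "pd j (of_int (sign p) * a) = of_int (sign p) * pd j a" for p a
    by (rule disjE[OF sign_cases[of p]]) (simp_all add: pd.neg)
  have "pd j jac = (\<Sum>p | p permutes {1..n}. of_int (sign p) * (\<Sum>l\<in>{1..n}. pd j (M l (p l)) * cof l p))"
    unfolding leibniz_det_def pd.sum sgn
    by (intro sum.cong refl arg_cong2[where f = "(*)"], subst pd_prod_list)
      (auto simp: M_Ev cof_def)
  also have "\<dots> = (\<Sum>l\<in>{1..n}. row_det l (\<lambda>m. pd j (M l m)))"
    unfolding row_det_def sum_distrib_left by (rule sum.swap)
  finally show ?thesis .
qed

text \<open>The analogue of Piola's identity: \<open>\<partial>\<^sub>j\<close> of the row \<open>(\<partial>\<^sub>m u(x\<^sub>l))\<^sub>m\<close> is minus the gradient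
  of \<open>\<partial>\<^sub>j u(x\<^sub>l)\<close>, which the chain rule writes as a combination of the rows of the Jacobian matrix;
  only row \<open>l\<close> itself contributes to the determinant.\<close>

lemma piola: "(\<Sum>k\<in>{1..n}. T k (jac * M k j)) = 0"
proof -
  have "row_det l (\<lambda>m. pd j (M l m)) = - T l (M l j) * jac" if l: "l \<in> {1..n}" for l
  proof -
    have "pd j (M l m) = (\<Sum>k\<in>{1..n}. - T k (M l j) * M k m)" for m
    proof -
      have "pd j (M l m) = - pd m (M l j)" unfolding M_def by (rule pd_anticommute)
      also have "\<dots> = (\<Sum>k\<in>{1..n}. - T k (M l j) * M k m)"
        by (subst pd_conv_T) (simp add: Ev_commute[OF M_Ev] sum_negf)
      finally show ?thesis .
    qed
    then have "row_det l (\<lambda>m. pd j (M l m)) = (\<Sum>k\<in>{1..n}. - T k (M l j) * row_det l (M k))"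
      by (simp only: row_det_lincomb)
    also have "\<dots> = (\<Sum>k\<in>{1..n}. if k = l then - T l (M l j) * jac else 0)"
      by (intro sum.cong refl) (use l in \<open>auto simp: row_det_self row_det_other\<close>)
    finally show ?thesis using l by simp
  qed
  then have "pd j jac = (\<Sum>l\<in>{1..n}. - T l (M l j) * jac)" by (simp add: pd_jac)
  \<comment> \<open>Summed over \<open>k\<close>, the first terms form \<open>pd j jac\<close> by
    \<open>pd_conv_T\<close> and cancel against the second ones.\<close>
  moreover have "T k (jac * M k j) = M k j * T k jac + T k (M k j) * jac" for k
    using Ev_commute[OF M_Ev, of k j "T k jac"] Ev_commute[OF jac_Ev, of "T k (M k j)"]
    by (simp add: T_Ev_mult[OF jac_Ev])
  ultimately show ?thesis
    by (simp add: sum.distrib sum_negf flip: pd_conv_T)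
qed

section \<open>Change of variables in the integral\<close>

lemma integral_v_jac_pd: "integral (v (jac * pd j a)) = 0"
proof -
  \<comment> \<open>The coefficients of a vector field that is divergence-free by
    \<open>piola\<close>; hence \<open>v (jac * pd j a)\<close> is a sum of the derivatives
    \<open>pd k (g k * v a)\<close>.\<close>
  define g where "g k = v (jac * M k j)" for k
  have g_Ev: "g k \<in> Ev" for k
    unfolding g_def by (intro v_Ev Ev_mult jac_Ev M_Ev)
  have "(\<Sum>k\<in>{1..n}. pd k (g k)) = v (\<Sum>k\<in>{1..n}. T k (jac * M k j))"
    by (simp add: g_def T_def v.sum)
  then have div: "(\<Sum>k\<in>{1..n}. pd k (g k)) = 0" by (simp add: piola v.zero)
  have "v (jac * pd j a) = (\<Sum>k\<in>{1..n}. g k * pd k (v a))"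
    by (subst pd_conv_T) (simp add: sum_distrib_left v.sum g_def T_def v_mult mult.assoc)
  also have "\<dots> = (\<Sum>k\<in>{1..n}. pd k (g k * v a)) - (\<Sum>k\<in>{1..n}. pd k (g k)) * v a"
    by (simp add: pd_Ev_mult[OF g_Ev] sum.distrib sum_distrib_right)
  finally show ?thesis by (simp add: div integral_sum)
qed

text \<open>In top degree only the linear parts of the images of the variables matter, so
  \<open>u\<close> scales \<open>vol x\<close> by their determinant; this is the constant term of
  \<open>jac\<close> because \<open>aug\<close> is multiplicative.\<close>

lemma u_vol: "u (vol x) = scale (aug jac) (vol x)"
proof -
  \<comment> \<open>The linear part of \<open>u (\<iota> (x i))\<close>, by
    \<open>Od_leading_part\<close>.\<close>
  define e where "e i = (\<Sum>j\<in>{1..n}. scaleV (aug (M i j)) (x j))" for i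
  have "u (wedge vs) = prod_list (map (\<lambda>w. u (\<iota> w)) vs)" for vs
    by (induction vs) (auto simp: u_mult)
  then have u_vol: "u (vol x) = prod_list (map (\<lambda>i. u (\<iota> (x i))) [1..<Suc n])"
    by (simp add: vol_def comp_def)
  have vol_e: "vol e = prod_list (map (\<lambda>i. \<iota> (e i)) [1..<Suc n])"
    by (simp add: vol_def wedge_def comp_def)
  have "u (\<iota> (x i)) - \<iota> (e i) \<in> graded {2..}" "\<iota> (e i) \<in> graded {1}" for i
    using Od_leading_part[OF u_iota, of "x i"] wedge_in_graded[of "[e i]" "{1}"]
    by (simp_all add: e_def M_def iota_sum iota_scale)
  then have "u (vol x) - vol e \<in> graded {n<..}"
    using prod_list_leading_part[of "[1..<Suc n]" "\<lambda>i. u (\<iota> (x i))" "\<lambda>i. \<iota> (e i)"]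
    by (simp add: u_vol vol_e)
  then have "u (vol x) = vol e" using graded_above_dim by fastforce
  also have "\<dots> = scale (\<Sum>p | p permutes {1..n}.
      of_int (sign p) * prod_list (map (\<lambda>i. aug (M i (p i))) [1..<Suc n])) (vol x)"
    unfolding e_def by (rule vol_expand)
  also have "(\<Sum>p | p permutes {1..n}.
      of_int (sign p) * prod_list (map (\<lambda>i. aug (M i (p i))) [1..<Suc n])) = aug jac"
  proof -
    interpret aug: Vector_Spaces.linear scale "(*)" aug by (rule linear_aug)
    have "aug (of_int (sign p)) = of_int (sign p)" for p :: "nat \<Rightarrow> nat"
      by (rule disjE[OF sign_cases[of p]]) (simp_all add: aug.neg)
    then show ?thesis
      by (simp add: leibniz_det_def aug.sum aug_mult aug_prod_list comp_def)
  qed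
  finally show ?thesis .
qed

text \<open>Otherwise the injective map \<open>u\<close> would kill the top monomial.\<close>

lemma aug_jac: "aug jac \<noteq> 0"
proof
  assume "aug jac = 0"
  then have "u (vol x) = 0" by (simp add: u_vol)
  then have "vol x = 0" using v_u[of "vol x"] v.zero by simp
  then show False using integral_vol by simp
qed

lemma integral_v_jac: "integral (v (jac * a)) = integral a"
proof -
  define f where "f a = integral (v (jac * a))" for a
  have "Vector_Spaces.linear scale (*) f"
    using linear_integral
    by unfold_locales
      (auto simp: f_def distrib_left v.add v.scale integral_add integral_scale A.scale_mult_right
        algebra_simps)
  then have f: "f a = f (vol x) * integral a" for a
    by (rule functional_eq_integral) (simp add: f_def integral_v_jac_pd)
  \<comment> \<open>The even factor \<open>v jac\<close> moves behind \<open>vol x\<close>, where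
    only its constant term survives.\<close>
  have "f (u (vol x)) = integral (vol x * v jac)"
    using Ev_commute[OF v_Ev[OF jac_Ev]] by (simp add: f_def v_mult)
  also have "\<dots> = aug jac" by (simp add: vol_mult integral_scale integral_vol aug_v)
  finally have "aug jac = f (vol x) * aug jac"
    using f[of "u (vol x)"] by (simp add: u_vol integral_scale integral_vol)
  then have "f (vol x) = 1" using aug_jac by simp
  then show ?thesis using f[of a] by (simp add: f_def)
qed

text \<open>The change of variables at \<open>b * a\<close>, with \<open>b\<close> inverse to
  \<open>jac\<close>, yields the defining equation for \<open>b\<close>; non-degeneracy, tested with
  second argument \<open>1\<close>, yields uniqueness.\<close>

lemma nakayama_jacobian_inverse:
  "is_inverse_of (nakayama_jacobian (ext_form scale \<iota> n x) v) jac"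
proof -
  obtain b where b: "jac * b = 1"
    using aug_nonzero_right_inverse[OF aug_jac] by blast
  have int: "integral (v a) = integral (b * a)" for a
    using integral_v_jac[of "b * a"] b by (simp flip: mult.assoc)
  have "nakayama_jacobian (ext_form scale \<iota> n x) v = b"
    unfolding nakayama_jacobian_def ext_form_def
  proof (rule the_equality)
    show "\<forall>a c. integral (v a * v c) = integral (b * a * c)"
      by (simp add: int mult.assoc flip: v_mult)
    fix j
    assume j: "\<forall>a c. integral (v a * v c) = integral (j * a * c)"
    have "integral ((j - b) * a) = 0" for a
      using j[rule_format, of a 1] int[of a]
      by (simp add: left_diff_distrib integral_diff flip: v_mult)
    then show "j = b" using integral_nondegenerate[of "j - b"] by simp
  qed
  then show ?thesis
    using b Ev_commute[OF jac_Ev, of b] by (simp add: is_inverse_of_def)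
qed

end

theorem proposition6:
  fixes scaleV :: "'k::field \<Rightarrow> 'v::ab_group_add \<Rightarrow> 'v"
    and scale :: "'k \<Rightarrow> 'a::ring_1 \<Rightarrow> 'a"
    and \<iota> :: "'v \<Rightarrow> 'a"
    and n :: nat
    and x :: "nat \<Rightarrow> 'v"
    and form :: "'a \<Rightarrow> 'a \<Rightarrow> 'k"
    and \<sigma> u :: "'a \<Rightarrow> 'a"
  assumes "CHAR('k) \<noteq> 2"
    and "ordered_basis scaleV n x"
    and "exterior_algebra scaleV scale \<iota>"
    and "form = ext_form scale \<iota> n x"
    and "\<sigma> = nakayama_automorphism scale form"
    and "u \<in> Aut_odd scale \<iota>"
  shows "is_inverse_of (nakayama_jacobian form (inv u)) (bavula_jacobian scale \<iota> n x u)"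
proof -
  interpret exterior_algebra scaleV scale \<iota> by fact
  have "(2::'k) \<noteq> 0"
  proof
    assume "(2::'k) = 0"
    then have "of_nat 2 = (0::'k)" by simp
    then have "CHAR('k) dvd 2" by (simp only: of_nat_eq_0_iff_char_dvd)
    moreover from this have "CHAR('k) \<le> 2" by (rule dvd_imp_le) simp
    moreover from this have "CHAR('k) = 0 \<or> CHAR('k) = 1" using assms(1) by linarith
    \<comment> \<open>0 does not divide 2, and a field cannot have characteristic 1.\<close>
    ultimately show False by auto
  qed
  then interpret odd_automorphism scaleV scale \<iota> n x u
    using assms by unfold_locales
  have "bavula_jacobian scale \<iota> n x u = jac"
    by (simp add: bavula_jacobian_def M_def[abs_def])
  then show ?thesis using nakayama_jacobian_inverse assms(4) by simp
qed

end
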